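(* Let $X=\mathbb T_\tau$. Consider two singular curves $X_{\mathfrak m}$ and $X_{\mathfrak m'}$ of genus $2$ with a node constructed from $X$. Assume that the supports of $\mathfrak m$ and $\mathfrak m'$ are $S=\{P_1=[z_1],P_2=[z_2]\}$ and $S'=\{P_1'=[z_1'],P_2'=[z_2']\}$ respectively. Then $X_{\mathfrak m}$ and $X_{\mathfrak m'}$ are biholomorphic if and only if $$z_1'-z_2'\equiv\gamma(z_1-z_2)\quad\mathrm{mod}\ \Gamma_\tau$$ for some complex number $\gamma$ such that $\gamma$ is a $4$th root of unity if $\Gamma_\tau$ is square, a $6$th root of unity if $\Gamma_\tau$ is hexagonal, and $\gamma=\pm1$ otherwise.
   Context: For $\tau$ in the upper half plane, $\Gamma_\tau=\mathbb Z+\tau\mathbb Z$ and $\mathbb T_\tau=\mathbb C/\Gamma_\tau$; $[z]$ is the class of $z\in\mathbb C$ modulo $\Gamma_\tau$. The lattice is square (resp. hexagonal) if it is homothetic to $\mathbb Z+\sqrt{-1}\,\mathbb Z$ (resp. $\mathbb Z+e^{\pi\sqrt{-1}/3}\mathbb Z$). For two distinct points $P_1,P_2\in X$, $S=\{P_1,P_2\}$ and $\mathfrak m(P_1)=\mathfrak m(P_2)=1$, the singular curve $X_{\mathfrak m}$ of genus $2$ with the only node $Q$ is the reduced complex space obtained by identifying $P_1$ and $P_2$ to one point $Q$: with $\rho:X\to (X\setminus S)\cup\{Q\}$ the projection (quotient topology), its structure sheaf has stalk $\mathcal O_{X,P}$ at $P\in X\setminus S$ and, at $Q$, consists of germs in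 $(\rho_*\mathcal O_X)_Q$ of the form constant plus a germ vanishing at both $P_1$ and $P_2$. $X_{\mathfrak m'}$ is defined in the same way from two distinct points $P_1',P_2'$. *)

theory Defs
  imports "HOL-Analysis.Analysis" "HOL-Algebra.QuotRing"
begin

section \<open>Ringed spaces over the complex numbers\<close>

text \<open>
  A topological space with a sheaf of complex algebras.  The algebra structure of the
  sections over \<open>U\<close> is given by the ring \<open>sheaf A U\<close> together with the structure map
  \<open>scalar A U\<close> from the complex numbers; \<open>restr A U V\<close> is the restriction from \<open>U\<close>
  to \<open>V \<subseteq> U\<close>.  Only the values on open sets matter.
\<close>

record ('p, 's) ringed_space =
  space_top :: "'p topology"
  sheaf :: "'p set \<Rightarrow> 's ring"
  scalar :: "'p set \<Rightarrow> complex \<Rightarrow> 's"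
  restr :: "'p set \<Rightarrow> 'p set \<Rightarrow> 's \<Rightarrow> 's"

definition pre :: "('p, 's) ringed_space \<Rightarrow> ('p \<Rightarrow> 'q) \<Rightarrow> 'q set \<Rightarrow> 'p set" where
  "pre A f V = {x \<in> topspace (space_top A). f x \<in> V}"

definition ringed_iso ::
  "('p, 's) ringed_space \<Rightarrow> ('q, 't) ringed_space \<Rightarrow> ('p \<Rightarrow> 'q) \<Rightarrow> ('q set \<Rightarrow> 't \<Rightarrow> 's) \<Rightarrow> bool"
where
  "ringed_iso A B f \<phi> \<longleftrightarrow>
     homeomorphic_map (space_top A) (space_top B) f \<and>
     (\<forall>V. openin (space_top B) V \<longrightarrow>
        \<phi> V \<in> ring_iso (sheaf B V) (sheaf A (pre A f V)) \<and>
        (\<forall>c. \<phi> V (scalar B V c) = scalar A (pre A f V) c)) \<and>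
     (\<forall>V W. openin (space_top B) V \<and> openin (space_top B) W \<and> W \<subseteq> V \<longrightarrow>
        (\<forall>s \<in> carrier (sheaf B V).
           \<phi> W (restr B V W s) = restr A (pre A f V) (pre A f W) (\<phi> V s)))"

text \<open>
  A biholomorphic map of complex spaces is an isomorphism of the ringed spaces.  (An
  isomorphism of sheaves automatically induces local homomorphisms on the stalks.)
\<close>

definition biholomorphic :: "('p, 's) ringed_space \<Rightarrow> ('q, 't) ringed_space \<Rightarrow> bool" where
  "biholomorphic A B \<longleftrightarrow> (\<exists>f \<phi>. ringed_iso A B f \<phi>)"

text \<open>The ring of the functions in \<open>F\<close>, all of them extensional on the domain \<open>D\<close>.\<close>

definition function_ring :: "'x set \<Rightarrow> ('x \<Rightarrow> complex) set \<Rightarrow> ('x \<Rightarrow> complex) ring" where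
  "function_ring D F =
     \<lparr> carrier = F,
       mult = (\<lambda>g h. \<lambda>x\<in>D. g x * h x),
       one = (\<lambda>x\<in>D. 1),
       zero = (\<lambda>x\<in>D. 0),
       add = (\<lambda>g h. \<lambda>x\<in>D. g x + h x) \<rparr>"

section \<open>Quotient topology\<close>

definition quotient_topology :: "'a topology \<Rightarrow> ('a \<Rightarrow> 'b) \<Rightarrow> 'b topology" where
  "quotient_topology T f =
     topology (\<lambda>V. V \<subseteq> f ` topspace T \<and> openin T {x \<in> topspace T. f x \<in> V})"

lemma openin_quotient_topology:
  "openin (quotient_topology T f) V \<longleftrightarrow>
     V \<subseteq> f ` topspace T \<and> openin T {x \<in> topspace T. f x \<in> V}"
proof -
  have "istopology (\<lambda>V. V \<subseteq> f ` topspace T \<and> openin T {x \<in> topspace T. f x \<in> V})"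
    unfolding istopology_def
  proof (intro conjI allI impI; (elim conjE)?)
    fix S U assume "openin T {x \<in> topspace T. f x \<in> S}" "openin T {x \<in> topspace T. f x \<in> U}"
    then have "openin T ({x \<in> topspace T. f x \<in> S} \<inter> {x \<in> topspace T. f x \<in> U})"
      by (rule openin_Int)
    also have "{x \<in> topspace T. f x \<in> S} \<inter> {x \<in> topspace T. f x \<in> U}
             = {x \<in> topspace T. f x \<in> S \<inter> U}" by auto
    finally show "openin T {x \<in> topspace T. f x \<in> S \<inter> U}" .
  next
    fix K assume K: "\<forall>V\<in>K. V \<subseteq> f ` topspace T \<and> openin T {x \<in> topspace T. f x \<in> V}"
    then have "openin T (\<Union>V\<in>K. {x \<in> topspace T. f x \<in> V})" by (intro openin_Union) auto
    also have "(\<Union>V\<in>K. {x \<in> topspace T. f x \<in> V}) = {x \<in> topspace T. f x \<in> \<Union>K}" by auto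
    finally show "openin T {x \<in> topspace T. f x \<in> \<Union>K}" .
  qed auto
  then show ?thesis by (simp add: quotient_topology_def)
qed

lemma topspace_quotient_topology: "topspace (quotient_topology T f) = f ` topspace T"
proof -
  have "{x \<in> topspace T. f x \<in> f ` topspace T} = topspace T" by auto
  then have "openin (quotient_topology T f) (f ` topspace T)"
    by (simp add: openin_quotient_topology)
  then show ?thesis
    by (meson openin_quotient_topology openin_subset openin_topspace subset_antisym)
qed

lemma quotient_map_quotient_topology: "quotient_map T (quotient_topology T f) f"
  by (auto simp: quotient_map_def topspace_quotient_topology openin_quotient_topology)

section \<open>The torus\<close>

definition period_lattice :: "complex \<Rightarrow> complex set" where
  "period_lattice \<tau> = {of_int m + of_int n * \<tau> | m n. True}"

definition homothetic :: "complex set \<Rightarrow> complex set \<Rightarrow> bool" where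
  "homothetic L M \<longleftrightarrow> (\<exists>a. a \<noteq> 0 \<and> L = (\<lambda>w. a * w) ` M)"

definition square_lattice :: "complex set \<Rightarrow> bool" where
  "square_lattice L \<longleftrightarrow> homothetic L (period_lattice \<i>)"

definition hexagonal_lattice :: "complex set \<Rightarrow> bool" where
  "hexagonal_lattice L \<longleftrightarrow> homothetic L (period_lattice (exp (of_real pi * \<i> / 3)))"

definition torus_class :: "complex \<Rightarrow> complex \<Rightarrow> complex set" where
  "torus_class \<tau> z = (\<lambda>w. z + w) ` period_lattice \<tau>"

definition torus_top :: "complex \<Rightarrow> complex set topology" where
  "torus_top \<tau> = quotient_topology euclidean (torus_class \<tau>)"

text \<open>
  The complex structure of the torus: the holomorphic functions on an open set \<open>U\<close> are
  those whose pullback to the complex plane is holomorphic.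
\<close>

definition torus_holo :: "complex \<Rightarrow> complex set set \<Rightarrow> (complex set \<Rightarrow> complex) set" where
  "torus_holo \<tau> U =
     {h \<in> extensional U. (\<lambda>z. h (torus_class \<tau> z)) holomorphic_on {z. torus_class \<tau> z \<in> U}}"

section \<open>The curve obtained from the torus by identifying the points of \<open>S\<close>\<close>

text \<open>
  The node is \<open>None\<close>; a point \<open>P\<close> of the torus outside \<open>S\<close> is \<open>Some P\<close>.
\<close>

definition node_proj :: "complex set set \<Rightarrow> complex set \<Rightarrow> complex set option" where
  "node_proj S P = (if P \<in> S then None else Some P)"

definition node_top :: "complex \<Rightarrow> complex set set \<Rightarrow> complex set option topology" where
  "node_top \<tau> S = quotient_topology (torus_top \<tau>) (node_proj S)"

definition node_preimage ::
  "complex \<Rightarrow> complex set set \<Rightarrow> complex set option set \<Rightarrow> complex set set" where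
  "node_preimage \<tau> S V = {P \<in> topspace (torus_top \<tau>). node_proj S P \<in> V}"

text \<open>
  The structure sheaf is a subsheaf of the direct image of the sheaf of holomorphic functions
  on the torus, so a section over \<open>V\<close> is a function on the preimage of \<open>V\<close> in the torus.
  The only condition is on the germ at the node: on some neighbourhood \<open>W\<close> of it the
  section is a constant plus a section \<open>g\<close> of the direct image that vanishes on \<open>S\<close>.
\<close>

definition node_sections ::
  "complex \<Rightarrow> complex set set \<Rightarrow> complex set option set \<Rightarrow> (complex set \<Rightarrow> complex) set" where
  "node_sections \<tau> S V =
     {h \<in> torus_holo \<tau> (node_preimage \<tau> S V).
        None \<in> V \<longrightarrow>
          (\<exists>W c g. openin (node_top \<tau> S) W \<and> None \<in> W \<and> W \<subseteq> V \<and>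
             g \<in> torus_holo \<tau> (node_preimage \<tau> S W) \<and> (\<forall>P\<in>S. g P = 0) \<and>
             (\<forall>P\<in>node_preimage \<tau> S W. h P = c + g P))}"

definition node_curve ::
  "complex \<Rightarrow> complex set set \<Rightarrow> (complex set option, complex set \<Rightarrow> complex) ringed_space" where
  "node_curve \<tau> S =
     \<lparr> space_top = node_top \<tau> S,
       sheaf = (\<lambda>V. function_ring (node_preimage \<tau> S V) (node_sections \<tau> S V)),
       scalar = (\<lambda>V c. \<lambda>P\<in>node_preimage \<tau> S V. c),
       restr = (\<lambda>V W h. restrict h (node_preimage \<tau> S W)) \<rparr>"

end

theory Submission
  imports Defs "HOL-Complex_Analysis.Conformal_Mappings"
begin

text \<open>
  An isomorphism of the nodal curves fixes the node for topological reasons, and away from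
  the node its sheaf part is composition with the underlying map, because the value of a section
  at a point is the only scalar that, subtracted from the section, leaves no germ invertible there.
  Hence the underlying map is holomorphic outside the two glued points; it lifts
  locally to the complex plane, across the glued points by Riemann's removability theorem.
  The derivatives of the local lifts form a periodic entire function, so they equal a constant
  \<open>\<gamma>\<close> by Liouville, and the map is induced by \<open>z \<mapsto> \<gamma> z + c\<close> with
  \<open>\<gamma> L = L\<close>, which takes the glued pair to the glued pair in one of the two orders.
  A multiplier \<open>\<gamma>\<close> of a lattice is an imaginary quadratic integer of norm 1 or a sign, and if it is
  not a sign, rounding to the nearest element of \<open>\<int>[\<gamma>]\<close> shows that the lattice
  is square or hexagonal.
\<close>

section \<open>Lattices and their multipliers\<close>

text \<open>\<open>ringed_iso\<close> ties the sheaf part \<open>\<phi>\<close> to the point map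
  \<open>f\<close> only through the domains and the restriction maps. No formula for
  \<open>\<phi>\<close> is given, so one has to be recovered by algebra before anything about
  \<open>f\<close> is known to be holomorphic. This is done over open sets that miss the node. The
  node itself enters the search for the affine map through topology: it is fixed, and its small
  neighbourhoods bound the lifts near the glued points. There \<open>f\<close> does not reveal which
  branch is hit, so both target branches are put into one chart. Local lifts are determined only up
  to lattice vectors, and these are discrete, so the derivatives agree where the lifts need not.
  Working with derivatives thus replaces the construction of a global lift. The condition on
  \<gamma> is carried as invariance of the lattice, the form in which both directions meet it; roots
  of unity appear only in the classification of multipliers. When the glued pair arrives in reversed
  order, the difference changes sign, and \<open>- \<gamma>\<close> takes over.\<close>

locale torus =
  fixes \<tau> :: complex
  assumes Im_pos: "Im \<tau> > 0"
begin

abbreviation "L \<equiv> period_lattice \<tau>"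
abbreviation "cls \<equiv> torus_class \<tau>"

end

lemma period_latticeI: "of_int m + of_int n * \<tau> \<in> period_lattice \<tau>"
  by (auto simp: period_lattice_def)

lemma period_latticeE:
  assumes "w \<in> period_lattice \<tau>"
  obtains m n where "w = of_int m + of_int n * \<tau>"
  using assms by (auto simp: period_lattice_def)

lemma period_lattice_0 [simp]: "0 \<in> period_lattice \<tau>"
  using period_latticeI[of 0 0] by simp

lemma period_lattice_1 [simp]: "1 \<in> period_lattice \<tau>"
  using period_latticeI[of 1 0] by simp

lemma period_lattice_period [simp]: "\<tau> \<in> period_lattice \<tau>"
  using period_latticeI[of 0 1] by simp

lemma period_lattice_add:
  assumes "v \<in> period_lattice \<tau>" "w \<in> period_lattice \<tau>"
  shows "v + w \<in> period_lattice \<tau>"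
proof -
  obtain a b c d where "v = of_int a + of_int b * \<tau>" "w = of_int c + of_int d * \<tau>"
    using assms by (meson period_latticeE)
  then have "v + w = of_int (a + c) + of_int (b + d) * \<tau>" by (simp add: algebra_simps)
  then show ?thesis by (metis period_latticeI)
qed

lemma period_lattice_minus:
  assumes "v \<in> period_lattice \<tau>"
  shows "- v \<in> period_lattice \<tau>"
proof -
  obtain a b where "v = of_int a + of_int b * \<tau>"
    using assms by (meson period_latticeE)
  then have "- v = of_int (- a) + of_int (- b) * \<tau>" by (simp add: algebra_simps)
  then show ?thesis by (metis period_latticeI)
qed

lemma period_lattice_minus_iff [simp]: "- v \<in> period_lattice \<tau> \<longleftrightarrow> v \<in> period_lattice \<tau>"
  by (metis minus_minus period_lattice_minus)

lemma period_lattice_diff: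
  "v \<in> period_lattice \<tau> \<Longrightarrow> w \<in> period_lattice \<tau> \<Longrightarrow> v - w \<in> period_lattice \<tau>"
  by (metis period_lattice_add period_lattice_minus diff_conv_add_uminus)

lemma period_lattice_diff_commute: "v - w \<in> period_lattice \<tau> \<longleftrightarrow> w - v \<in> period_lattice \<tau>"
  by (metis minus_diff_eq period_lattice_minus_iff)

lemma period_lattice_scale:
  assumes "v \<in> period_lattice \<tau>"
  shows "of_int k * v \<in> period_lattice \<tau>"
proof -
  obtain a b where "v = of_int a + of_int b * \<tau>"
    using assms by (meson period_latticeE)
  then have "of_int k * v = of_int (k * a) + of_int (k * b) * \<tau>" by (simp add: algebra_simps)
  then show ?thesis by (metis period_latticeI)
qed

lemma countable_period_lattice: "countable (period_lattice \<tau>)"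
proof -
  have "period_lattice \<tau> = (\<lambda>(m, n). of_int m + of_int n * \<tau>) ` UNIV"
    by (auto simp: period_lattice_def)
  then show ?thesis by simp
qed

lemma torus_class_eq_iff:
  "torus_class \<tau> z = torus_class \<tau> w \<longleftrightarrow> z - w \<in> period_lattice \<tau>"
proof
  assume "torus_class \<tau> z = torus_class \<tau> w"
  moreover have "z \<in> torus_class \<tau> z"
    unfolding torus_class_def using period_lattice_0[of \<tau>] by force
  ultimately show "z - w \<in> period_lattice \<tau>"
    by (auto simp: torus_class_def)
next
  assume *: "z - w \<in> period_lattice \<tau>"
  have "z + v \<in> torus_class \<tau> w" if "v \<in> period_lattice \<tau>" for v
    unfolding torus_class_def using period_lattice_add[OF * that]
    by (intro image_eqI[of _ _ "z - w + v"]) auto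
  moreover have "w + v \<in> torus_class \<tau> z" if "v \<in> period_lattice \<tau>" for v
    unfolding torus_class_def using period_lattice_diff[OF that *]
    by (intro image_eqI[of _ _ "v - (z - w)"]) auto
  ultimately show "torus_class \<tau> z = torus_class \<tau> w"
    unfolding torus_class_def by blast
qed

lemma torus_class_add [simp]:
  "l \<in> period_lattice \<tau> \<Longrightarrow> torus_class \<tau> (z + l) = torus_class \<tau> z"
  by (simp add: torus_class_eq_iff)

lemma period_lattice_power_mult:
  assumes "\<And>l. l \<in> period_lattice \<tau> \<Longrightarrow> \<gamma> * l \<in> period_lattice \<tau>"
  shows "\<gamma> ^ n \<in> period_lattice \<tau>"
  by (induction n) (auto intro: assms)

context torus
begin

text \<open>A lower bound for nonzero lattice vectors: if the coefficient of \<open>\<tau>\<close>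
  is nonzero, the imaginary part is at least \<open>Im \<tau>\<close> in absolute value; otherwise
  the vector is an integer.\<close>

definition gap :: real where "gap = min 1 (Im \<tau>)"

lemma gap_pos: "gap > 0"
  using Im_pos by (simp add: gap_def)

lemma small_lattice_zero:
  assumes "v \<in> L" "norm v < gap"
  shows "v = 0"
proof -
  obtain m n where v: "v = of_int m + of_int n * \<tau>" using assms(1) by (rule period_latticeE)
  have "\<bar>of_int n\<bar> * Im \<tau> = \<bar>Im v\<bar>" using Im_pos by (simp add: v abs_mult)
  also have "\<dots> < Im \<tau>" using abs_Im_le_cmod[of v] assms(2) by (simp add: gap_def)
  finally have n: "n = 0" using Im_pos by (simp add: mult_less_cancel_right1)
  then have "\<bar>real_of_int m\<bar> < 1" using assms(2) by (simp add: v gap_def)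
  then show ?thesis by (simp add: v n)
qed

lemma lattice_separated:
  "\<lbrakk>v \<in> L; w \<in> L; dist v w < gap\<rbrakk> \<Longrightarrow> v = w"
  using small_lattice_zero[OF period_lattice_diff] by (simp add: dist_norm)

lemma closed_lattice: "closed L"
  using gap_pos lattice_separated by (metis discrete_imp_closed)

text \<open>Since \<open>1 \<in> L\<close>, all powers of \<open>\<gamma>\<close> lie in
  \<open>L\<close>; if the norm were below 1, some power would be nonzero and yet shorter than
  \<open>gap\<close>.\<close>

lemma lattice_multiplier_norm_ge_1:
  assumes "\<gamma> \<noteq> 0" and mult: "\<And>l. l \<in> L \<Longrightarrow> \<gamma> * l \<in> L"
  shows "norm \<gamma> \<ge> 1"
proof (rule ccontr)
  assume "\<not> ?thesis"
  then obtain n where "norm \<gamma> ^ n < gap"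
    using gap_pos real_arch_pow_inv[of gap "norm \<gamma>"] by auto
  then have "\<gamma> ^ n = 0"
    using period_lattice_power_mult[OF mult] by (intro small_lattice_zero) (auto simp: norm_power)
  then show False using assms(1) by simp
qed

lemma lattice_multiplier_norm:
  assumes "(\<lambda>w. \<gamma> * w) ` L = L"
  shows "norm \<gamma> = 1"
proof -
  have "1 \<in> (\<lambda>w. \<gamma> * w) ` L" by (simp add: assms)
  then obtain l where l: "l \<in> L" "1 = \<gamma> * l" by blast
  have ne: "\<gamma> \<noteq> 0" using l by auto
  have inv: "inverse \<gamma> * l \<in> L" if "l \<in> L" for l
  proof -
    have "l \<in> (\<lambda>w. \<gamma> * w) ` L" using that by (simp add: assms)
    then obtain k where "k \<in> L" "l = \<gamma> * k" by blast
    then show ?thesis using ne by (simp flip: mult.assoc)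
  qed
  have "norm \<gamma> \<ge> 1"
    using assms ne by (intro lattice_multiplier_norm_ge_1) auto
  moreover have "norm (inverse \<gamma>) \<ge> 1"
    using inv ne by (intro lattice_multiplier_norm_ge_1) auto
  ultimately show ?thesis using ne by (simp add: norm_inverse one_le_inverse_iff)
qed

text \<open>Cayley-Hamilton for multiplication by \<open>\<gamma>\<close> in the basis
  \<open>1\<close>, \<open>\<tau>\<close>: \<open>t\<close> is the trace and \<open>d\<close> the
  determinant of its integer matrix.\<close>

lemma lattice_multiplier_quadratic:
  assumes "\<And>l. l \<in> L \<Longrightarrow> \<gamma> * l \<in> L"
  obtains t d :: int where "\<gamma>\<^sup>2 - of_int t * \<gamma> + of_int d = 0"
proof -
  obtain a b where ab: "\<gamma> * 1 = of_int a + of_int b * \<tau>"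
    using assms[of 1] by (meson period_lattice_1 period_latticeE)
  obtain c e where ce: "\<gamma> * \<tau> = of_int c + of_int e * \<tau>"
    using assms[of \<tau>] by (meson period_lattice_period period_latticeE)
  have "(\<gamma> - of_int a) * (\<gamma> - of_int e) = of_int b * (\<gamma> * \<tau> - of_int e * \<tau>)"
    using ab by (simp add: algebra_simps)
  also have "\<dots> = of_int b * of_int c" by (simp add: ce)
  finally have "\<gamma>\<^sup>2 - of_int (a + e) * \<gamma> + of_int (a * e - b * c) = 0"
    by (simp add: algebra_simps power2_eq_square)
  then show ?thesis by (rule that)
qed

lemma shortest_vector:
  obtains a where "a \<in> L" "a \<noteq> 0" "\<And>w. w \<in> L \<Longrightarrow> w \<noteq> 0 \<Longrightarrow> norm a \<le> norm w"
proof -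
  have "closed (L - {0})"
    by (rule discrete_imp_closed[OF gap_pos]) (auto dest: lattice_separated)
  moreover have "1 \<in> L - {0}" by simp
  then have "L - {0} \<noteq> {}" by blast
  ultimately obtain a where "a \<in> L - {0}" "\<And>w. w \<in> L - {0} \<Longrightarrow> dist 0 a \<le> dist 0 w"
    using distance_attains_inf[of "L - {0}" 0] by blast
  then show ?thesis using that[of a] by simp
qed

text \<open>Euclidean division: \<open>L\<close> is stable under integral combinations of
  \<open>1\<close> and \<open>\<gamma>\<close>, and dividing \<open>w\<close> by a shortest vector
  \<open>a\<close> with rounded quotient leaves a remainder in \<open>L\<close> shorter than
  \<open>a\<close>, hence zero. So \<open>a\<close> generates \<open>L\<close>.\<close>

lemma homothetic_if_multiplier:
  assumes mult: "\<And>l. l \<in> L \<Longrightarrow> \<gamma> * l \<in> L"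
    and round: "\<And>z::complex. \<exists>m n. norm (z - (of_int m + of_int n * \<gamma>)) < 1"
  shows "homothetic L (period_lattice \<gamma>)"
proof -
  obtain a where a: "a \<in> L" "a \<noteq> 0" "\<And>w. w \<in> L \<Longrightarrow> w \<noteq> 0 \<Longrightarrow> norm a \<le> norm w"
    by (rule shortest_vector) blast
  have sub: "a * (of_int m + of_int n * \<gamma>) \<in> L" for m n
  proof -
    have "of_int m * a + of_int n * (\<gamma> * a) \<in> L"
      by (intro period_lattice_add period_lattice_scale mult a)
    then show ?thesis by (simp add: algebra_simps)
  qed
  have "\<exists>m n. w = a * (of_int m + of_int n * \<gamma>)" if w: "w \<in> L" for w
  proof -
    obtain m n where mn: "norm (w / a - (of_int m + of_int n * \<gamma>)) < 1" using round by blast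
    define r where "r = w - a * (of_int m + of_int n * \<gamma>)"
    have "r \<in> L" unfolding r_def by (intro period_lattice_diff w sub)
    moreover have "r = a * (w / a - (of_int m + of_int n * \<gamma>))"
      using a(2) by (simp add: r_def field_simps)
    then have "norm r < norm a" using mn a(2) by (simp add: norm_mult)
    ultimately have "r = 0" using a(3) by force
    then show ?thesis unfolding r_def by auto
  qed
  then have "L \<subseteq> (\<lambda>w. a * w) ` period_lattice \<gamma>"
    using period_latticeI by (metis imageI subsetI)
  moreover have "(\<lambda>w. a * w) ` period_lattice \<gamma> \<subseteq> L"
    using sub by (metis image_subsetI period_latticeE)
  ultimately have "L = (\<lambda>w. a * w) ` period_lattice \<gamma>" by blast
  then show ?thesis using a(2) by (auto simp: homothetic_def)
qed

end

section \<open>Gaussian and Eisenstein integers, and the multipliers of the model lattices\<close>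

definition hexagonal_unit :: complex where "hexagonal_unit = exp (of_real pi * \<i> / 3)"

lemma hexagonal_unit_eq: "hexagonal_unit = Complex (1/2) (sqrt 3 / 2)"
proof -
  have "hexagonal_unit = cis (pi / 3)" by (simp add: hexagonal_unit_def cis_conv_exp mult.commute)
  then show ?thesis by (simp add: cos_60 sin_60 complex_eq_iff)
qed

lemma hexagonal_unit_square: "hexagonal_unit\<^sup>2 = hexagonal_unit - 1"
  by (simp add: hexagonal_unit_eq complex_eq_iff power2_eq_square)

lemma square_le_quarter: "\<bar>x\<bar> \<le> 1/2 \<Longrightarrow> x\<^sup>2 \<le> (1/4 :: real)"
  using abs_le_square_iff[of x "1/2"] by (simp add: power2_eq_square)

lemma gaussian_rounding: "\<exists>m n. norm (z - (of_int m + of_int n * \<i>)) < 1"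
proof (intro exI)
  let ?w = "z - (of_int (round (Re z)) + of_int (round (Im z)) * \<i>)"
  have "\<bar>Re ?w\<bar> \<le> 1/2" "\<bar>Im ?w\<bar> \<le> 1/2"
    using of_int_round_abs_le[of "Re z"] of_int_round_abs_le[of "Im z"]
    by (simp_all add: abs_minus_commute)
  then have "(Re ?w)\<^sup>2 \<le> 1/4" "(Im ?w)\<^sup>2 \<le> 1/4"
    by (blast intro: square_le_quarter)+
  then have "(norm ?w)\<^sup>2 \<le> 1/2" unfolding cmod_power2 by linarith
  also have "(1/2::real) < 1\<^sup>2" by simp
  finally show "norm ?w < 1" by (rule power_less_imp_less_base) simp
qed

text \<open>\<open>x\<close> and \<open>y\<close> are the real coordinates of \<open>z\<close> in
  the basis \<open>1\<close>, \<open>hexagonal_unit\<close>. Rounding leaves errors of at most 1/2,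
  for which the norm form \<open>u\<^sup>2 + u * v + v\<^sup>2\<close> is at most 3/4.\<close>

lemma eisenstein_rounding: "\<exists>m n. norm (z - (of_int m + of_int n * hexagonal_unit)) < 1"
proof (intro exI)
  define y where "y = 2 * Im z / sqrt 3"
  define x where "x = Re z - y / 2"
  define u where "u = x - round x"
  define v where "v = y - round y"
  let ?w = "z - (of_int (round x) + of_int (round y) * hexagonal_unit)"
  have u: "\<bar>u\<bar> \<le> 1/2" and v: "\<bar>v\<bar> \<le> 1/2"
    unfolding u_def v_def using of_int_round_abs_le[of x] of_int_round_abs_le[of y]
    by (simp_all add: abs_minus_commute)
  have "Re z = x + y / 2" "Im z = y * (sqrt 3 / 2)"
    by (simp_all add: x_def y_def)
  then have "Re ?w = u + v / 2" "Im ?w = v * (sqrt 3 / 2)"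
    by (simp_all add: hexagonal_unit_eq u_def v_def algebra_simps diff_divide_distrib)
  then have "(norm ?w)\<^sup>2 = (u + v / 2)\<^sup>2 + (v * (sqrt 3 / 2))\<^sup>2"
    by (simp only: cmod_power2)
  also have "\<dots> = u\<^sup>2 + u * v + v\<^sup>2"
    by (simp add: power2_eq_square algebra_simps)
  also have "\<dots> \<le> 1/4 + (1/2) * (1/2) + 1/4"
  proof (intro add_mono)
    show "u\<^sup>2 \<le> 1/4" "v\<^sup>2 \<le> 1/4"
      using u v by (blast intro: square_le_quarter)+
    have "\<bar>u * v\<bar> \<le> (1/2) * (1/2)" unfolding abs_mult using u v by (intro mult_mono) auto
    then show "u * v \<le> (1/2) * (1/2)" by linarith
  qed
  also have "\<dots> < 1\<^sup>2" by simp
  finally show "norm ?w < 1" by (rule power_less_imp_less_base) simp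
qed

text \<open>Scaling commutes with multiplication by \<open>\<gamma>\<close>, so the multipliers of a
  square or hexagonal lattice can be computed in the model.\<close>

lemma homothetic_multiplier:
  assumes "homothetic (period_lattice \<tau>) (period_lattice \<sigma>)"
  shows "(\<forall>l\<in>period_lattice \<tau>. \<gamma> * l \<in> period_lattice \<tau>) \<longleftrightarrow>
         (\<forall>l\<in>period_lattice \<sigma>. \<gamma> * l \<in> period_lattice \<sigma>)"
proof -
  obtain a where a: "a \<noteq> 0" "period_lattice \<tau> = (\<lambda>w. a * w) ` period_lattice \<sigma>"
    using assms by (auto simp: homothetic_def)
  have "\<gamma> * (a * l) \<in> (\<lambda>w. a * w) ` period_lattice \<sigma> \<longleftrightarrow> \<gamma> * l \<in> period_lattice \<sigma>" for l
    using a(1) by (auto simp: image_iff mult.left_commute)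
  then show ?thesis by (auto simp: a(2))
qed

lemma multiplier_if_generators:
  assumes "\<gamma> \<in> period_lattice \<tau>" "\<gamma> * \<tau> \<in> period_lattice \<tau>" "l \<in> period_lattice \<tau>"
  shows "\<gamma> * l \<in> period_lattice \<tau>"
proof -
  obtain m n where "l = of_int m + of_int n * \<tau>" using assms(3) by (rule period_latticeE)
  then have "\<gamma> * l = of_int m * \<gamma> + of_int n * (\<gamma> * \<tau>)" by (simp add: algebra_simps)
  then show ?thesis using assms by (simp add: period_lattice_add period_lattice_scale)
qed

lemma square_lattice_multiplier:
  assumes "square_lattice (period_lattice \<tau>)" "\<gamma> ^ 4 = 1" "l \<in> period_lattice \<tau>"
  shows "\<gamma> * l \<in> period_lattice \<tau>"
proof -
  have "(\<gamma>\<^sup>2 - 1) * (\<gamma>\<^sup>2 + 1) = 0" using assms(2) by (simp add: algebra_simps flip: power_add)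
  then have "\<gamma>\<^sup>2 = 1\<^sup>2 \<or> \<gamma>\<^sup>2 = \<i>\<^sup>2" by (auto simp: eq_neg_iff_add_eq_0)
  then have "\<gamma> \<in> {1, -1, \<i>, -\<i>}" unfolding power2_eq_iff by blast
  then have "\<gamma> \<in> period_lattice \<i>" "\<gamma> * \<i> \<in> period_lattice \<i>" by auto
  then have "\<forall>l\<in>period_lattice \<i>. \<gamma> * l \<in> period_lattice \<i>"
    using multiplier_if_generators by blast
  then show ?thesis
    using assms homothetic_multiplier[of \<tau> \<i> \<gamma>] by (auto simp: square_lattice_def)
qed

lemma hexagonal_lattice_multiplier:
  assumes "hexagonal_lattice (period_lattice \<tau>)" "\<gamma> ^ 6 = 1" "l \<in> period_lattice \<tau>"
  shows "\<gamma> * l \<in> period_lattice \<tau>"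
proof -
  let ?w = hexagonal_unit
  let ?E = "period_lattice ?w"
  have w2: "?w * ?w = ?w - 1" using hexagonal_unit_square by (simp add: power2_eq_square)
  \<comment> \<open>The cyclotomic factors of \<open>\<gamma> ^ 6 - 1\<close>, split further:
    \<open>\<gamma>\<^sup>2 - \<gamma> + 1\<close> has the roots \<open>?w\<close> and
    \<open>1 - ?w\<close>, and the other quadratic factor has their negatives.\<close>
  have "(\<gamma> - 1) * (\<gamma> + 1) * ((\<gamma> - ?w) * (\<gamma> - (1 - ?w))) * ((\<gamma> + ?w) * (\<gamma> + (1 - ?w))) = 0"
  proof -
    have "(\<gamma> - ?w) * (\<gamma> - (1 - ?w)) = \<gamma> * \<gamma> - \<gamma> + 1" "(\<gamma> + ?w) * (\<gamma> + (1 - ?w)) = \<gamma> * \<gamma> + \<gamma> + 1"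
      by (simp_all add: algebra_simps w2)
    moreover have "(\<gamma> - 1) * (\<gamma> + 1) * (\<gamma> * \<gamma> - \<gamma> + 1) * (\<gamma> * \<gamma> + \<gamma> + 1) = \<gamma> ^ 6 - 1"
      by (simp add: algebra_simps eval_nat_numeral)
    ultimately show ?thesis using assms(2) by simp
  qed
  then have cases: "\<gamma> \<in> {1, -1, ?w, 1 - ?w, -?w, - (1 - ?w)}"
    unfolding mult_eq_0_iff eq_iff_diff_eq_0[of \<gamma>] insert_iff diff_minus_eq_add by blast
  have gen: "\<gamma> \<in> ?E"
    using cases by (auto intro: period_lattice_diff)
  moreover have "(1 - ?w) * ?w = 1" by (simp add: left_diff_distrib w2)
  then have "\<gamma> * ?w \<in> {?w, - ?w, ?w - 1, 1, - (?w - 1), - 1}"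
    using cases by (elim insertE emptyE) (simp_all only: mult_minus_left w2, auto)
  then have "\<gamma> * ?w \<in> ?E"
    by (elim insertE emptyE)
      (simp_all only: period_lattice_diff period_lattice_minus_iff period_lattice_1 period_lattice_period)
  ultimately have "\<forall>l\<in>?E. \<gamma> * l \<in> ?E"
    using multiplier_if_generators by blast
  then show ?thesis
    using assms homothetic_multiplier[of \<tau> ?w \<gamma>]
    by (auto simp: hexagonal_lattice_def hexagonal_unit_def)
qed

lemma (in torus) lattice_multiplier_iff:
  "(\<lambda>w. \<gamma> * w) ` L = L \<longleftrightarrow>
     (if square_lattice L then \<gamma> ^ 4 = 1
      else if hexagonal_lattice L then \<gamma> ^ 6 = 1
      else \<gamma> = 1 \<or> \<gamma> = -1)" (is "_ \<longleftrightarrow> ?C \<gamma>")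
proof
  assume C: "?C \<gamma>"
  have mult: "\<gamma> * l \<in> L" if "?C \<gamma>" "l \<in> L" for \<gamma> l
    using that square_lattice_multiplier hexagonal_lattice_multiplier by (auto split: if_splits)
  have ne: "\<gamma> \<noteq> 0" using C by (auto split: if_splits)
  have "?C (inverse \<gamma>)" using C ne by (auto simp: power_inverse split: if_splits)
  then have "inverse \<gamma> * l \<in> L" if "l \<in> L" for l using mult that by blast
  moreover have "l = \<gamma> * (inverse \<gamma> * l)" for l using ne by simp
  ultimately show "(\<lambda>w. \<gamma> * w) ` L = L" using mult[OF C] by blast
next
  assume eq: "(\<lambda>w. \<gamma> * w) ` L = L"
  then have mult: "\<And>l. l \<in> L \<Longrightarrow> \<gamma> * l \<in> L" by blast
  have norm: "norm \<gamma> = 1" using eq by (rule lattice_multiplier_norm)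
  then have n2: "(Re \<gamma>)\<^sup>2 + (Im \<gamma>)\<^sup>2 = 1" by (metis cmod_power2 one_power2)
  obtain t d :: int where q: "\<gamma>\<^sup>2 - of_int t * \<gamma> + of_int d = 0"
    using lattice_multiplier_quadratic[OF mult] by blast
  have cases: "\<gamma> = 1 \<or> \<gamma> = -1 \<or> (\<bar>Re \<gamma>\<bar> = 1/2 \<and> \<bar>Im \<gamma>\<bar> = sqrt 3 / 2) \<or> (Re \<gamma> = 0 \<and> \<bar>Im \<gamma>\<bar> = 1)"
  proof (cases "Im \<gamma> = 0")
    case True
    then have "Re \<gamma> = 1 \<or> Re \<gamma> = -1" using n2 by (simp add: power2_eq_1_iff)
    with True show ?thesis by (auto simp: complex_eq_iff)
  next
    case False
    \<comment> \<open>For nonreal \<open>\<gamma>\<close> the imaginary part of the quadratic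
      relation makes \<open>t\<close> twice the real part; norm 1 then leaves only -1, 0 and 1 for
      \<open>t\<close>.\<close>
    have "Im (\<gamma>\<^sup>2 - of_int t * \<gamma> + of_int d) = Im \<gamma> * (2 * Re \<gamma> - t)"
      by (simp add: power2_eq_square algebra_simps)
    then have t: "Re \<gamma> = t / 2" using q False by simp
    have "(Im \<gamma>)\<^sup>2 > 0" using False by simp
    then have "(Re \<gamma>)\<^sup>2 < 1" using n2 by linarith
    then have lt: "(t / 2)\<^sup>2 < 1" by (simp only: t)
    then have "\<bar>t / 2\<bar> < 1" by (simp only: abs_square_less_1)
    then have "\<bar>t\<bar> < 2" by linarith
    then have "t = 0 \<or> \<bar>t\<bar> = 1" by linarith
    then show ?thesis
    proof
      assume "t = 0"
      then show ?thesis using n2 t by (auto simp: power2_eq_1_iff)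
    next
      assume "\<bar>t\<bar> = 1"
      then have re: "\<bar>Re \<gamma>\<bar> = 1/2" using t by linarith
      then have "(Re \<gamma>)\<^sup>2 = (1/2)\<^sup>2" by (metis power2_abs)
      then have "(Im \<gamma>)\<^sup>2 = 3/4" using n2 by (simp add: power2_eq_square)
      then have "\<bar>Im \<gamma>\<bar> = sqrt (3/4)" by (metis real_sqrt_abs)
      then show ?thesis using re by (simp add: real_sqrt_divide)
    qed
  qed
  have pm: "\<bar>x\<bar> = y \<Longrightarrow> x = y \<or> x = - y" for x y :: real by linarith
  show "?C \<gamma>"
  proof (cases "square_lattice L")
    case True
    have "\<gamma> \<in> period_lattice \<i>"
      using homothetic_multiplier[of \<tau> \<i> \<gamma>] True mult unfolding square_lattice_def
      by (metis mult.right_neutral period_lattice_1)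
    then obtain m n where mn: "\<gamma> = of_int m + of_int n * \<i>" by (rule period_latticeE)
    \<comment> \<open>A multiplier of a square lattice is a Gaussian integer, and its integral real
      part rules out the nonreal sixth roots of unity.\<close>
    have "\<bar>Re \<gamma>\<bar> \<noteq> 1/2"
    proof
      assume "\<bar>Re \<gamma>\<bar> = 1/2"
      moreover have "Re \<gamma> = of_int m" by (simp add: mn)
      ultimately have "real_of_int (2 * m) = of_int 1 \<or> real_of_int (2 * m) = of_int (- 1)"
        unfolding of_int_mult by (auto dest!: pm)
      then show False unfolding of_int_eq_iff by presburger
    qed
    then have "\<gamma> \<in> {1, -1, \<i>, -\<i>}" using cases by (auto simp: complex_eq_iff dest!: pm)
    then have "\<gamma> ^ 4 = 1" by auto
    then show ?thesis using True by simp
  next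
    case False
    have not_i: "\<not> (Re \<gamma> = 0 \<and> \<bar>Im \<gamma>\<bar> = 1)"
    proof
      assume "Re \<gamma> = 0 \<and> \<bar>Im \<gamma>\<bar> = 1"
      then have "\<gamma> = \<i> \<or> \<gamma> = -\<i>" by (auto simp: complex_eq_iff dest!: pm)
      then have "\<i> * l \<in> L" if "l \<in> L" for l
        using mult[OF that] by (metis mult_minus_left period_lattice_minus_iff)
      then have "square_lattice L"
        unfolding square_lattice_def by (intro homothetic_if_multiplier gaussian_rounding)
      with False show False by simp
    qed
    show ?thesis
    proof (cases "\<gamma> = 1 \<or> \<gamma> = -1")
      case True
      then show ?thesis using False by auto
    next
      case ne: False
      then have "\<bar>Re \<gamma>\<bar> = 1/2" "\<bar>Im \<gamma>\<bar> = sqrt 3 / 2" using cases not_i by auto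
      then have hex: "\<gamma> \<in> {hexagonal_unit, - hexagonal_unit, 1 - hexagonal_unit, - (1 - hexagonal_unit)}"
        by (auto simp: complex_eq_iff hexagonal_unit_eq dest!: pm)
      \<comment> \<open>Each of the four candidates is \<open>hexagonal_unit\<close> up to a sign
        and an added integer, so \<open>L\<close> is stable under \<open>hexagonal_unit\<close> as
        well.\<close>
      have "hexagonal_unit * l \<in> L" if "l \<in> L" for l
      proof -
        have "\<gamma> * l = hexagonal_unit * l \<or> \<gamma> * l = - (hexagonal_unit * l) \<or>
              \<gamma> * l = l - hexagonal_unit * l \<or> \<gamma> * l = hexagonal_unit * l - l"
          using hex by (elim insertE emptyE) (simp_all add: left_diff_distrib)
        then show ?thesis
          using mult[OF that] that period_lattice_add[of "\<gamma> * l" \<tau> l]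
            period_lattice_diff[of l \<tau> "\<gamma> * l"] by auto
      qed
      then have "hexagonal_lattice L"
        unfolding hexagonal_lattice_def hexagonal_unit_def[symmetric]
        by (intro homothetic_if_multiplier eisenstein_rounding)
      moreover have "\<gamma> ^ 6 = 1"
      proof -
        have w2: "hexagonal_unit * hexagonal_unit = hexagonal_unit - 1"
          using hexagonal_unit_square by (simp add: power2_eq_square)
        have "hexagonal_unit ^ 3 = -1" "(1 - hexagonal_unit) ^ 3 = -1"
          by (simp_all add: power3_eq_cube algebra_simps w2)
        moreover from this have "(- hexagonal_unit) ^ 3 = 1" "(- (1 - hexagonal_unit)) ^ 3 = 1"
          by (simp_all del: minus_diff_eq)
        ultimately have "\<gamma> ^ 3 = 1 \<or> \<gamma> ^ 3 = -1"
          using hex by (elim insertE emptyE) (simp_all only: simp_thms)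
        moreover have "\<gamma> ^ 6 = \<gamma> ^ 3 * \<gamma> ^ 3" by (simp flip: power_add)
        ultimately show ?thesis by (elim disjE) simp_all
      qed
      ultimately show ?thesis using False by simp
    qed
  qed
qed

section \<open>The topology of the torus and of the nodal curve\<close>

context torus
begin

text \<open>The projection from the plane to the nodal curve; with it the two successive quotients
  are treated as one.\<close>

definition node_class :: "complex set set \<Rightarrow> complex \<Rightarrow> complex set option" where
  "node_class S z = node_proj S (cls z)"

lemma node_class_eq_None [simp]: "node_class S z = None \<longleftrightarrow> cls z \<in> S"
  by (simp add: node_class_def node_proj_def)

lemma node_class_eq_Some [simp]: "node_class S z = Some P \<longleftrightarrow> cls z \<notin> S \<and> P = cls z"
  by (auto simp: node_class_def node_proj_def)

lemma node_class_eq_None' [simp]: "None = node_class S z \<longleftrightarrow> cls z \<in> S"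
  by (auto simp: node_class_def node_proj_def)

lemma node_class_eq_Some' [simp]: "Some P = node_class S z \<longleftrightarrow> cls z \<notin> S \<and> P = cls z"
  by (auto simp: node_class_def node_proj_def)

lemma node_class_outside: "cls z \<notin> S \<Longrightarrow> node_class S z = Some (cls z)"
  by simp

lemma topspace_torus: "topspace (torus_top \<tau>) = range cls"
  by (simp add: torus_top_def topspace_quotient_topology)

lemma topspace_node: "topspace (node_top \<tau> S) = range (node_class S)"
  by (auto simp: node_top_def topspace_quotient_topology topspace_torus node_class_def)

lemma openin_torus: "openin (torus_top \<tau>) V \<longleftrightarrow> V \<subseteq> range cls \<and> open {z. cls z \<in> V}"
  by (simp add: torus_top_def openin_quotient_topology)

lemma openin_node:
  "openin (node_top \<tau> S) V \<longleftrightarrow> V \<subseteq> range (node_class S) \<and> open {z. node_class S z \<in> V}"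
proof -
  have "{z. cls z \<in> {P \<in> range cls. node_proj S P \<in> V}} = {z. node_class S z \<in> V}"
    by (auto simp: node_class_def)
  moreover have "node_proj S ` range cls = range (node_class S)"
    by (auto simp: node_class_def)
  ultimately show ?thesis
    by (simp add: node_top_def openin_quotient_topology openin_torus topspace_torus subset_iff)
qed

lemma mem_node_preimage: "P \<in> node_preimage \<tau> S V \<longleftrightarrow> (\<exists>z. P = cls z \<and> node_class S z \<in> V)"
  by (auto simp: node_preimage_def topspace_torus node_class_def)

lemma cls_in_node_preimage [simp]: "cls z \<in> node_preimage \<tau> S V \<longleftrightarrow> node_class S z \<in> V"
  by (auto simp: node_preimage_def topspace_torus node_class_def)

lemma mem_torus_holo:
  "h \<in> torus_holo \<tau> U \<longleftrightarrow>
     h \<in> extensional U \<and> (\<lambda>z. h (cls z)) holomorphic_on {z. cls z \<in> U}"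
  by (simp add: torus_holo_def)

lemma node_sections_away:
  "None \<notin> V \<Longrightarrow> node_sections \<tau> S V = torus_holo \<tau> (node_preimage \<tau> S V)"
  by (simp add: node_sections_def)

lemma saturation_eq: "{z. cls z \<in> cls ` U} = (\<Union>l\<in>L. (\<lambda>w. l + w) ` U)"
proof -
  have "z \<in> (\<Union>l\<in>L. (\<lambda>w. l + w) ` U)" if "w \<in> U" "cls z = cls w" for z w
    using that by (auto simp: torus_class_eq_iff intro!: bexI[of _ "z - w"] image_eqI[of _ _ w])
  moreover have "cls (l + w) \<in> cls ` U" if "l \<in> L" "w \<in> U" for l w
    using that by (intro image_eqI[of _ _ w]) (simp_all add: torus_class_eq_iff)
  ultimately show ?thesis by blast
qed

lemma open_saturation: "open U \<Longrightarrow> open {z. cls z \<in> cls ` U}"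
  unfolding saturation_eq by (intro open_UN ballI open_translation)

text \<open>Away from \<open>S\<close> the gluing changes nothing. A small disc around just one of
  two glued points would not do: its image contains the node but no neighbourhood of it on the other
  branch.\<close>

lemma openin_node_class_image:
  assumes "open U" "\<And>z. z \<in> U \<Longrightarrow> cls z \<notin> S"
  shows "openin (node_top \<tau> S) (node_class S ` U)"
proof -
  have "{z. node_class S z \<in> node_class S ` U} = {z. cls z \<in> cls ` U}"
    using assms(2) by (force simp: node_class_outside image_iff node_class_def node_proj_def split: if_splits)
  then show ?thesis using open_saturation[OF assms(1)] by (auto simp: openin_node)
qed

text \<open>Distinct representatives of one class are at least \<open>gap\<close> apart, so the
  points over \<open>S\<close> do not accumulate, and limits at them can be taken through the
  complement.\<close>

lemma eventually_cls_notin: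
  assumes "finite S"
  shows "eventually (\<lambda>z. cls z \<notin> S) (at a)"
proof -
  have "eventually (\<lambda>z. cls z \<noteq> P) (at a)" for P
  proof -
    have "\<not> a islimpt {z. cls z = P}"
    proof (rule discrete_imp_not_islimpt[OF gap_pos])
      fix x y assume "x \<in> {z. cls z = P}" "y \<in> {z. cls z = P}" "dist y x < gap"
      then have "y - x \<in> L" by (simp flip: torus_class_eq_iff)
      then show "y = x" using small_lattice_zero[of "y - x"] \<open>dist y x < gap\<close> by (simp add: dist_norm)
    qed
    then show ?thesis by (simp add: islimpt_iff_eventually)
  qed
  then have "eventually (\<lambda>z. \<forall>P\<in>S. cls z \<noteq> P) (at a)"
    using assms by (intro eventually_ball_finite) auto
  then show ?thesis by (rule eventually_mono) auto
qed

lemma closed_class_preimage: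
  assumes "finite S"
  shows "closed {z. cls z \<in> S}"
  using eventually_cls_notin[OF assms] by (simp add: closed_limpt islimpt_iff_eventually)

lemma countable_class_preimage:
  assumes "finite S"
  shows "countable {z. cls z \<in> S}"
proof -
  have "countable {z. cls z = P}" for P
  proof (cases "P \<in> range cls")
    case True
    then obtain p where p: "P = cls p" by blast
    have "{z. cls z = P} \<subseteq> (\<lambda>l. p + l) ` L"
    proof
      fix z assume "z \<in> {z. cls z = P}"
      then have "z - p \<in> L" by (simp add: p torus_class_eq_iff)
      then show "z \<in> (\<lambda>l. p + l) ` L" by (rule image_eqI[rotated]) simp
    qed
    then show ?thesis by (rule countable_subset) (simp add: countable_period_lattice)
  next
    case False
    then have "{z. cls z = P} = {}" by auto
    then show ?thesis by simp
  qed
  then have "countable (\<Union>P\<in>S. {z. cls z = P})"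
    using assms by (intro countable_UN) (auto simp: countable_finite)
  moreover have "(\<Union>P\<in>S. {z. cls z = P}) = {z. cls z \<in> S}" by auto
  ultimately show ?thesis by simp
qed

lemma inj_on_cls_ball: "inj_on cls (ball b (gap / 2))"
proof (rule inj_onI)
  fix x y assume xy: "x \<in> ball b (gap / 2)" "y \<in> ball b (gap / 2)" "cls x = cls y"
  have "dist x y < gap" using xy dist_triangle_half_r[of b x gap y] by simp
  then show "x = y"
    using small_lattice_zero[of "x - y"] xy(3) by (simp add: dist_norm torus_class_eq_iff)
qed

text \<open>Provides one coordinate for both branches at the node. The discs stay disjoint on the
  torus because \<open>L\<close> is closed: some ball around \<open>a - b\<close> misses it, and
  \<open>r\<close> is at most half its radius.\<close>

lemma inj_on_cls_two_balls:
  assumes "cls a \<noteq> cls b"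
  obtains r where "r > 0" "inj_on cls (ball a r \<union> ball b r)" "\<And>x y. x \<in> ball a r \<Longrightarrow> y \<in> ball b r \<Longrightarrow> cls x \<noteq> cls y"
proof -
  have "a - b \<in> - L" using assms by (simp add: torus_class_eq_iff)
  moreover have "open (- L)" using closed_lattice by blast
  ultimately obtain e where e: "e > 0" "ball (a - b) e \<subseteq> - L" using open_contains_ball by blast
  define r where "r = min (gap / 2) (e / 2)"
  have r: "r > 0" "r \<le> gap / 2" "2 * r \<le> e" using e gap_pos by (auto simp: r_def)
  have ne: "cls x \<noteq> cls y" if "x \<in> ball a r" "y \<in> ball b r" for x y
  proof
    assume "cls x = cls y"
    then have "x - y \<in> L" by (simp add: torus_class_eq_iff)
    moreover have "dist (a - b) (x - y) < e"
    proof -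
      have "dist (a - b) (x - y) \<le> dist a x + dist b y"
        unfolding dist_norm using norm_triangle_ineq4[of "a - x" "b - y"] by (simp add: algebra_simps)
      then show ?thesis using that r by auto
    qed
    ultimately show False using e by auto
  qed
  have "inj_on cls (ball c r)" for c
    using inj_on_cls_ball[of c] by (rule inj_on_subset) (use r(2) in auto)
  then have "inj_on cls (ball a r \<union> ball b r)"
    using ne unfolding inj_on_def by (metis Un_iff)
  then show ?thesis using that r ne by blast
qed

text \<open>On the translate of \<open>B\<close> by \<open>l\<close> the pullback is
  \<open>z - l\<close>. This section is the coordinate to which the sheaf isomorphism is applied
  later.\<close>

lemma local_inverse_holo:
  assumes "open B" "inj_on cls B"
  shows "restrict (inv_into B cls) (cls ` B) \<in> torus_holo \<tau> (cls ` B)"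
proof -
  have "(\<lambda>z. restrict (inv_into B cls) (cls ` B) (cls z)) holomorphic_on (\<Union>l\<in>L. (\<lambda>w. l + w) ` B)"
  proof (rule holomorphic_on_UN_open)
    fix l assume l: "l \<in> L"
    have eq: "z - l = restrict (inv_into B cls) (cls ` B) (cls z)" if z: "z \<in> (\<lambda>w. l + w) ` B" for z
    proof -
      obtain w where w: "w \<in> B" "z = l + w" using z by blast
      then have "cls z = cls w" using l by (simp add: torus_class_eq_iff)
      then show ?thesis using w assms(2) by simp
    qed
    have "(\<lambda>z. z - l) holomorphic_on (\<lambda>w. l + w) ` B" by (intro holomorphic_intros)
    then show "(\<lambda>z. restrict (inv_into B cls) (cls ` B) (cls z)) holomorphic_on (\<lambda>w. l + w) ` B"
      by (rule holomorphic_transform) (rule eq)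
    show "open ((\<lambda>w. l + w) ` B)" using assms(1) by (rule open_translation)
  qed
  then show ?thesis by (simp add: mem_torus_holo saturation_eq)
qed

end

section \<open>Affine maps induce isomorphisms\<close>

context torus
begin

text \<open>Acts on a class as a set, so that no representative has to be chosen; the result is
  again a class when multiplication by \<open>\<gamma>\<close> maps \<open>L\<close> onto
  itself.\<close>

definition affine_image :: "complex \<Rightarrow> complex \<Rightarrow> complex set \<Rightarrow> complex set" where
  "affine_image \<gamma> c P = (\<lambda>z. \<gamma> * z + c) ` P"

lemma affine_cls:
  assumes "(\<lambda>w. \<gamma> * w) ` L = L"
  shows "affine_image \<gamma> c (cls z) = cls (\<gamma> * z + c)"
proof -
  have "affine_image \<gamma> c (cls z) = (\<lambda>w. \<gamma> * z + c + w) ` ((\<lambda>w. \<gamma> * w) ` L)"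
    by (simp add: affine_image_def torus_class_def image_image algebra_simps)
  then show ?thesis by (simp add: assms torus_class_def)
qed

text \<open>The inverse map is affine with parameters \<open>inverse \<gamma>\<close> and
  \<open>- (c / \<gamma>)\<close>. The converse halves of bijectivity and of the homeomorphism below
  are the forward statements for these parameters.\<close>

lemma affine_point_inverse:
  fixes \<gamma> :: complex
  assumes "\<gamma> \<noteq> 0"
  shows "inverse \<gamma> * (\<gamma> * z + c) + - (c / \<gamma>) = z" "\<gamma> * (inverse \<gamma> * z + - (c / \<gamma>)) + c = z"
  using assms
  by (simp_all add: divide_inverse distrib_left right_diff_distrib mult.commute[of c] flip: mult.assoc)

lemma affine_inverse:
  "\<gamma> \<noteq> 0 \<Longrightarrow> affine_image (inverse \<gamma>) (- (c / \<gamma>)) (affine_image \<gamma> c P) = P"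
  "\<gamma> \<noteq> 0 \<Longrightarrow> affine_image \<gamma> c (affine_image (inverse \<gamma>) (- (c / \<gamma>)) P) = P"
  by (simp_all only: affine_image_def image_image image_ident affine_point_inverse not_False_eq_True)

lemma inj_affine: "\<gamma> \<noteq> 0 \<Longrightarrow> inj (affine_image \<gamma> c)"
  by (rule inj_on_inverseI) (rule affine_inverse(1))

lemma affine_in_image_iff: "\<gamma> \<noteq> 0 \<Longrightarrow> affine_image \<gamma> c P \<in> affine_image \<gamma> c ` S \<longleftrightarrow> P \<in> S"
  by (rule inj_image_mem_iff[OF inj_affine])

lemma multiplier_nonzero: "(\<lambda>w. \<gamma> * w) ` L = L \<Longrightarrow> \<gamma> \<noteq> 0"
  by (auto dest: lattice_multiplier_norm)

lemma multiplier_inverse: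
  assumes "(\<lambda>w. \<gamma> * w) ` L = L"
  shows "(\<lambda>w. inverse \<gamma> * w) ` L = L"
proof -
  have "(\<lambda>w. inverse \<gamma> * w) ` L = (\<lambda>w. inverse \<gamma> * w) ` (\<lambda>w. \<gamma> * w) ` L" by (simp add: assms)
  also have "\<dots> = L" using multiplier_nonzero[OF assms] by (simp add: image_image flip: mult.assoc)
  finally show ?thesis .
qed

lemma map_option_affine_node_class:
  assumes "(\<lambda>w. \<gamma> * w) ` L = L"
  shows "map_option (affine_image \<gamma> c) (node_class S z) = node_class (affine_image \<gamma> c ` S) (\<gamma> * z + c)"
  using affine_in_image_iff[OF multiplier_nonzero[OF assms], of c "cls z" S]
  by (simp add: node_class_def node_proj_def affine_cls[OF assms])

section \<open>Pullback of sections along an affine map\<close>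

definition affine_pre :: "complex \<Rightarrow> complex \<Rightarrow> complex set set \<Rightarrow> complex set option set \<Rightarrow> complex set option set" where
  "affine_pre \<gamma> c S V = {x \<in> range (node_class S). map_option (affine_image \<gamma> c) x \<in> V}"

definition affine_pullback ::
  "complex \<Rightarrow> complex \<Rightarrow> complex set set \<Rightarrow> complex set option set \<Rightarrow> (complex set \<Rightarrow> complex) \<Rightarrow> complex set \<Rightarrow> complex" where
  "affine_pullback \<gamma> c S V h = (\<lambda>P\<in>node_preimage \<tau> S (affine_pre \<gamma> c S V). h (affine_image \<gamma> c P))"

lemma node_class_in_affine_pre:
  assumes "(\<lambda>w. \<gamma> * w) ` L = L"
  shows "node_class S z \<in> affine_pre \<gamma> c S V \<longleftrightarrow> node_class (affine_image \<gamma> c ` S) (\<gamma> * z + c) \<in> V"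
  by (simp add: affine_pre_def map_option_affine_node_class[OF assms])

lemma affine_in_node_preimage:
  assumes "(\<lambda>w. \<gamma> * w) ` L = L" "P \<in> node_preimage \<tau> S (affine_pre \<gamma> c S V)"
  shows "affine_image \<gamma> c P \<in> node_preimage \<tau> (affine_image \<gamma> c ` S) V"
  using assms(2) by (auto simp: mem_node_preimage node_class_in_affine_pre[OF assms(1)] affine_cls[OF assms(1)])

lemma openin_affine_pre:
  assumes "(\<lambda>w. \<gamma> * w) ` L = L" "openin (node_top \<tau> (affine_image \<gamma> c ` S)) V"
  shows "openin (node_top \<tau> S) (affine_pre \<gamma> c S V)"
proof -
  have "open ((\<lambda>z. \<gamma> * z + c) -` {z. node_class (affine_image \<gamma> c ` S) z \<in> V})"
    using assms(2) by (intro open_vimage continuous_intros) (simp add: openin_node)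
  moreover have "affine_pre \<gamma> c S V \<subseteq> range (node_class S)" by (auto simp: affine_pre_def)
  ultimately show ?thesis by (simp add: openin_node node_class_in_affine_pre[OF assms(1)] vimage_def)
qed

lemma affine_pre_inverse:
  assumes "\<gamma> \<noteq> 0" "V \<subseteq> range (node_class (affine_image \<gamma> c ` S))" "(\<lambda>w. \<gamma> * w) ` L = L"
  shows "affine_pre (inverse \<gamma>) (- (c / \<gamma>)) (affine_image \<gamma> c ` S) (affine_pre \<gamma> c S V) = V"
proof -
  have S: "affine_image (inverse \<gamma>) (- (c / \<gamma>)) ` affine_image \<gamma> c ` S = S"
    by (simp add: image_image affine_inverse assms(1))
  have "node_class (affine_image \<gamma> c ` S) z \<in> affine_pre (inverse \<gamma>) (- (c / \<gamma>)) (affine_image \<gamma> c ` S) (affine_pre \<gamma> c S V)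
      \<longleftrightarrow> node_class (affine_image \<gamma> c ` S) z \<in> V" for z
    using node_class_in_affine_pre[OF multiplier_inverse[OF assms(3)], of "affine_image \<gamma> c ` S" z "- (c / \<gamma>)"]
      node_class_in_affine_pre[OF assms(3), of S "inverse \<gamma> * z + - (c / \<gamma>)" c V]
    unfolding S affine_point_inverse(2)[OF assms(1)] by simp
  then show ?thesis using assms(2) unfolding affine_pre_def[of "inverse \<gamma>"] by blast
qed

lemma affine_pullback_holo:
  assumes "(\<lambda>w. \<gamma> * w) ` L = L" "h \<in> torus_holo \<tau> (node_preimage \<tau> (affine_image \<gamma> c ` S) V)"
  shows "affine_pullback \<gamma> c S V h \<in> torus_holo \<tau> (node_preimage \<tau> S (affine_pre \<gamma> c S V))"
proof -
  have "(\<lambda>w. h (cls w)) \<circ> (\<lambda>z. \<gamma> * z + c) holomorphic_on {z. node_class S z \<in> affine_pre \<gamma> c S V}"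
    using assms(2)
    by (intro holomorphic_on_compose_gen[where t = "{z. node_class (affine_image \<gamma> c ` S) z \<in> V}"] holomorphic_intros)
      (auto simp: mem_torus_holo node_class_in_affine_pre[OF assms(1)])
  then have "(\<lambda>z. affine_pullback \<gamma> c S V h (cls z)) holomorphic_on {z. node_class S z \<in> affine_pre \<gamma> c S V}"
    by (rule holomorphic_transform) (simp add: affine_pullback_def affine_cls[OF assms(1)])
  then show ?thesis by (simp add: mem_torus_holo) (simp add: affine_pullback_def)
qed

text \<open>The splitting at the node into a constant and a section vanishing on the glued points
  pulls back term by term with the same constant, because \<open>affine_image \<gamma> c\<close>
  carries glued points to glued points.\<close>

lemma affine_pullback_sections:
  assumes mult: "(\<lambda>w. \<gamma> * w) ` L = L" and S: "S \<subseteq> range cls"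
    and h: "h \<in> node_sections \<tau> (affine_image \<gamma> c ` S) V"
  shows "affine_pullback \<gamma> c S V h \<in> node_sections \<tau> S (affine_pre \<gamma> c S V)"
  unfolding node_sections_def
proof (intro CollectI conjI impI)
  show "affine_pullback \<gamma> c S V h \<in> torus_holo \<tau> (node_preimage \<tau> S (affine_pre \<gamma> c S V))"
    using h by (intro affine_pullback_holo mult) (simp add: node_sections_def)
  assume None: "None \<in> affine_pre \<gamma> c S V"
  then have "None \<in> V" by (simp add: affine_pre_def)
  with h obtain W d g where W: "openin (node_top \<tau> (affine_image \<gamma> c ` S)) W" "None \<in> W" "W \<subseteq> V"
    and g: "g \<in> torus_holo \<tau> (node_preimage \<tau> (affine_image \<gamma> c ` S) W)" "\<forall>P\<in>affine_image \<gamma> c ` S. g P = 0"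
      "\<forall>P\<in>node_preimage \<tau> (affine_image \<gamma> c ` S) W. h P = d + g P"
    by (auto simp: node_sections_def)
  show "\<exists>W d g. openin (node_top \<tau> S) W \<and> None \<in> W \<and> W \<subseteq> affine_pre \<gamma> c S V \<and>
      g \<in> torus_holo \<tau> (node_preimage \<tau> S W) \<and> (\<forall>P\<in>S. g P = 0) \<and>
      (\<forall>P\<in>node_preimage \<tau> S W. affine_pullback \<gamma> c S V h P = d + g P)"
  proof (intro exI conjI ballI)
    show "openin (node_top \<tau> S) (affine_pre \<gamma> c S W)" by (rule openin_affine_pre[OF mult W(1)])
    show NW: "None \<in> affine_pre \<gamma> c S W" using None W(2) by (simp add: affine_pre_def)
    show sub: "affine_pre \<gamma> c S W \<subseteq> affine_pre \<gamma> c S V" using W(3) by (auto simp: affine_pre_def)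
    show "affine_pullback \<gamma> c S W g \<in> torus_holo \<tau> (node_preimage \<tau> S (affine_pre \<gamma> c S W))"
      by (rule affine_pullback_holo[OF mult g(1)])
    show "affine_pullback \<gamma> c S W g P = 0" if "P \<in> S" for P
    proof -
      obtain z where z: "P = cls z" using S \<open>P \<in> S\<close> by blast
      then have "node_class S z = None" using that by simp
      \<comment> \<open>Membership matters: outside its domain the restricted function is
        \<open>undefined\<close>, not 0.\<close>
      then have "P \<in> node_preimage \<tau> S (affine_pre \<gamma> c S W)" using NW unfolding z cls_in_node_preimage by metis
      then show ?thesis using g(2) that by (simp add: affine_pullback_def)
    qed
    show "affine_pullback \<gamma> c S V h P = d + affine_pullback \<gamma> c S W g P"
      if "P \<in> node_preimage \<tau> S (affine_pre \<gamma> c S W)" for P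
    proof -
      have "P \<in> node_preimage \<tau> S (affine_pre \<gamma> c S V)"
        using that sub by (auto simp: node_preimage_def)
      then show ?thesis
        using that g(3) affine_in_node_preimage[OF mult that] by (simp add: affine_pullback_def)
    qed
  qed
qed

lemma affine_pullback_inverse:
  assumes mult: "(\<lambda>w. \<gamma> * w) ` L = L" and V: "V \<subseteq> range (node_class (affine_image \<gamma> c ` S))"
  shows "h \<in> extensional (node_preimage \<tau> (affine_image \<gamma> c ` S) V) \<Longrightarrow>
      affine_pullback (inverse \<gamma>) (- (c / \<gamma>)) (affine_image \<gamma> c ` S) (affine_pre \<gamma> c S V) (affine_pullback \<gamma> c S V h) = h"
    "k \<in> extensional (node_preimage \<tau> S (affine_pre \<gamma> c S V)) \<Longrightarrow>
      affine_pullback \<gamma> c S V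
        (affine_pullback (inverse \<gamma>) (- (c / \<gamma>)) (affine_image \<gamma> c ` S) (affine_pre \<gamma> c S V) k) = k"
proof -
  note ne = multiplier_nonzero[OF mult]
  have S: "affine_image (inverse \<gamma>) (- (c / \<gamma>)) ` affine_image \<gamma> c ` S = S"
    by (simp add: image_image affine_inverse ne)
  note pre = affine_pre_inverse[OF ne V mult]
  have bwd: "affine_image (inverse \<gamma>) (- (c / \<gamma>)) P \<in> node_preimage \<tau> S (affine_pre \<gamma> c S V)"
    if "P \<in> node_preimage \<tau> (affine_image \<gamma> c ` S) V" for P
    using affine_in_node_preimage[OF multiplier_inverse[OF mult], of P "affine_image \<gamma> c ` S" "- (c / \<gamma>)" "affine_pre \<gamma> c S V"]
      that unfolding pre S .
  show "affine_pullback (inverse \<gamma>) (- (c / \<gamma>)) (affine_image \<gamma> c ` S) (affine_pre \<gamma> c S V) (affine_pullback \<gamma> c S V h) = h"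
    if "h \<in> extensional (node_preimage \<tau> (affine_image \<gamma> c ` S) V)"
  proof (rule extensionalityI[OF _ that])
    show "affine_pullback (inverse \<gamma>) (- (c / \<gamma>)) (affine_image \<gamma> c ` S) (affine_pre \<gamma> c S V) (affine_pullback \<gamma> c S V h)
        \<in> extensional (node_preimage \<tau> (affine_image \<gamma> c ` S) V)"
      unfolding affine_pullback_def[of "inverse \<gamma>"] pre by simp
  qed (use bwd in \<open>simp add: affine_pullback_def pre affine_inverse ne\<close>)
  show "affine_pullback \<gamma> c S V
      (affine_pullback (inverse \<gamma>) (- (c / \<gamma>)) (affine_image \<gamma> c ` S) (affine_pre \<gamma> c S V) k) = k"
    if "k \<in> extensional (node_preimage \<tau> S (affine_pre \<gamma> c S V))"
  proof (rule extensionalityI[OF _ that])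
    show "affine_pullback \<gamma> c S V (affine_pullback (inverse \<gamma>) (- (c / \<gamma>)) (affine_image \<gamma> c ` S) (affine_pre \<gamma> c S V) k)
        \<in> extensional (node_preimage \<tau> S (affine_pre \<gamma> c S V))"
      unfolding affine_pullback_def[of \<gamma>] by simp
  qed (use affine_in_node_preimage[OF mult] in \<open>simp add: affine_pullback_def pre affine_inverse ne\<close>)
qed

lemma affine_pullback_ring_iso:
  assumes mult: "(\<lambda>w. \<gamma> * w) ` L = L" and S: "S \<subseteq> range cls"
    and V: "V \<subseteq> range (node_class (affine_image \<gamma> c ` S))"
  shows "affine_pullback \<gamma> c S V \<in> ring_iso
    (function_ring (node_preimage \<tau> (affine_image \<gamma> c ` S) V) (node_sections \<tau> (affine_image \<gamma> c ` S) V))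
    (function_ring (node_preimage \<tau> S (affine_pre \<gamma> c S V)) (node_sections \<tau> S (affine_pre \<gamma> c S V)))"
proof (rule ring_iso_memI)
  note ne = multiplier_nonzero[OF mult]
  have S': "affine_image (inverse \<gamma>) (- (c / \<gamma>)) ` affine_image \<gamma> c ` S = S"
    by (simp add: image_image affine_inverse ne)
  have S'r: "affine_image \<gamma> c ` S \<subseteq> range cls"
    using S by (auto simp: affine_cls[OF mult])
  note fwd = affine_pullback_sections[OF mult S]
  note bwd = affine_pullback_sections[OF multiplier_inverse[OF mult] S'r,
      of _ "- (c / \<gamma>)" "affine_pre \<gamma> c S V", unfolded S' affine_pre_inverse[OF ne V mult]]
  have ext: "h \<in> extensional (node_preimage \<tau> T W)" if "h \<in> node_sections \<tau> T W" for h T W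
    using that by (simp add: node_sections_def mem_torus_holo)
  show "bij_betw (affine_pullback \<gamma> c S V)
     (carrier (function_ring (node_preimage \<tau> (affine_image \<gamma> c ` S) V) (node_sections \<tau> (affine_image \<gamma> c ` S) V)))
     (carrier (function_ring (node_preimage \<tau> S (affine_pre \<gamma> c S V)) (node_sections \<tau> S (affine_pre \<gamma> c S V))))"
    unfolding function_ring_def partial_object.simps
    by (rule bij_betw_byWitness[where f' = "affine_pullback (inverse \<gamma>) (- (c / \<gamma>)) (affine_image \<gamma> c ` S) (affine_pre \<gamma> c S V)"])
      (auto intro: fwd bwd affine_pullback_inverse[OF mult V] ext)
qed (use affine_pullback_sections[OF mult S] affine_in_node_preimage[OF mult] in
    \<open>auto simp: function_ring_def affine_pullback_def intro!: restrict_ext\<close>)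

lemma homeomorphic_map_affine:
  assumes mult: "(\<lambda>w. \<gamma> * w) ` L = L"
  shows "homeomorphic_map (node_top \<tau> S) (node_top \<tau> (affine_image \<gamma> c ` S)) (map_option (affine_image \<gamma> c))"
proof -
  note ne = multiplier_nonzero[OF mult]
  have surj: "\<exists>z. w = \<gamma> * z + c" for w
    using ne by (intro exI[of _ "(w - c) / \<gamma>"]) simp
  have "map_option (affine_image \<gamma> c) ` range (node_class S) = range (node_class (affine_image \<gamma> c ` S))"
    using surj by (auto simp: image_image map_option_affine_node_class[OF mult] image_iff) metis
  moreover have "openin (node_top \<tau> S) {x \<in> range (node_class S). map_option (affine_image \<gamma> c) x \<in> U} \<longleftrightarrow>
      openin (node_top \<tau> (affine_image \<gamma> c ` S)) U" if U: "U \<subseteq> range (node_class (affine_image \<gamma> c ` S))" for U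
  proof
    assume *: "openin (node_top \<tau> S) {x \<in> range (node_class S). map_option (affine_image \<gamma> c) x \<in> U}"
    have S': "affine_image (inverse \<gamma>) (- (c / \<gamma>)) ` affine_image \<gamma> c ` S = S"
      by (simp add: image_image affine_inverse ne)
    have "openin (node_top \<tau> (affine_image \<gamma> c ` S))
        (affine_pre (inverse \<gamma>) (- (c / \<gamma>)) (affine_image \<gamma> c ` S) (affine_pre \<gamma> c S U))"
      using * by (intro openin_affine_pre[OF multiplier_inverse[OF mult]]) (simp add: S' affine_pre_def)
    then show "openin (node_top \<tau> (affine_image \<gamma> c ` S)) U"
      by (simp add: affine_pre_inverse[OF ne U mult])
  next
    assume "openin (node_top \<tau> (affine_image \<gamma> c ` S)) U"
    then show "openin (node_top \<tau> S) {x \<in> range (node_class S). map_option (affine_image \<gamma> c) x \<in> U}"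
      using openin_affine_pre[OF mult] by (simp add: affine_pre_def)
  qed
  moreover have "inj (map_option (affine_image \<gamma> c))"
    using inj_affine[OF ne] by (rule option.inj_map)
  ultimately show ?thesis
    by (auto simp: homeomorphic_map_def quotient_map_def topspace_node intro: inj_on_subset)
qed

theorem biholomorphic_affine:
  assumes mult: "(\<lambda>w. \<gamma> * w) ` L = L" and S: "S \<subseteq> range cls"
  shows "biholomorphic (node_curve \<tau> S) (node_curve \<tau> (affine_image \<gamma> c ` S))"
proof -
  have pre: "pre (node_curve \<tau> S) (map_option (affine_image \<gamma> c)) V = affine_pre \<gamma> c S V" for V
    by (simp add: pre_def affine_pre_def node_curve_def topspace_node)
  have sub: "node_preimage \<tau> S (affine_pre \<gamma> c S W) \<subseteq> node_preimage \<tau> S (affine_pre \<gamma> c S V)"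
    if "W \<subseteq> V" for V W
    using that by (auto simp: node_preimage_def affine_pre_def)
  have "ringed_iso (node_curve \<tau> S) (node_curve \<tau> (affine_image \<gamma> c ` S)) (map_option (affine_image \<gamma> c)) (affine_pullback \<gamma> c S)"
    unfolding ringed_iso_def pre
  proof (intro conjI allI impI ballI; (elim conjE)?)
    show "homeomorphic_map (space_top (node_curve \<tau> S)) (space_top (node_curve \<tau> (affine_image \<gamma> c ` S))) (map_option (affine_image \<gamma> c))"
      using homeomorphic_map_affine[OF mult] by (simp add: node_curve_def)
  next
    fix V assume "openin (space_top (node_curve \<tau> (affine_image \<gamma> c ` S))) V"
    then have "V \<subseteq> range (node_class (affine_image \<gamma> c ` S))" by (simp add: node_curve_def openin_node)
    then show "affine_pullback \<gamma> c S V \<in> ring_iso (sheaf (node_curve \<tau> (affine_image \<gamma> c ` S)) V)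
        (sheaf (node_curve \<tau> S) (affine_pre \<gamma> c S V))"
      using affine_pullback_ring_iso[OF mult S] by (simp add: node_curve_def)
  next
    fix V and d :: complex
    show "affine_pullback \<gamma> c S V (scalar (node_curve \<tau> (affine_image \<gamma> c ` S)) V d) =
      scalar (node_curve \<tau> S) (affine_pre \<gamma> c S V) d"
      using affine_in_node_preimage[OF mult]
      by (auto simp: node_curve_def affine_pullback_def intro!: restrict_ext)
  next
    fix V W :: "complex set option set" and h assume "W \<subseteq> V"
    then show "affine_pullback \<gamma> c S W (restr (node_curve \<tau> (affine_image \<gamma> c ` S)) V W h) =
      restr (node_curve \<tau> S) (affine_pre \<gamma> c S V) (affine_pre \<gamma> c S W) (affine_pullback \<gamma> c S V h)"
      using affine_in_node_preimage[OF mult] subsetD[OF sub]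
      by (auto simp: node_curve_def affine_pullback_def intro!: restrict_ext)
  qed
  then show ?thesis by (auto simp: biholomorphic_def)
qed

end

section \<open>Isomorphisms are given by composition\<close>

context torus
begin

lemma torus_holo_restrictI:
  "(\<lambda>z. g (cls z)) holomorphic_on {z. cls z \<in> D} \<Longrightarrow> restrict g D \<in> torus_holo \<tau> D"
  unfolding mem_torus_holo by (auto intro: holomorphic_transform)

text \<open>Counterpart of \<open>openin_node_class_image\<close> at the node: an open set around
  the node contains a piece of every branch, so \<open>U\<close> has to reach all points of
  \<open>S\<close>.\<close>

lemma openin_node_class_image_node:
  assumes "open U" "S \<subseteq> cls ` U"
  shows "openin (node_top \<tau> S) (node_class S ` U)"
proof -
  have "{z. node_class S z \<in> node_class S ` U} = {z. cls z \<in> cls ` U}"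
    using assms(2) by (fastforce simp: node_class_def node_proj_def split: if_splits)
  then show ?thesis using open_saturation[OF assms(1)] by (auto simp: openin_node)
qed

end

section \<open>Two nodal curves over one torus with an isomorphism between them\<close>

locale node_iso = torus +
  fixes p1 p2 q1 q2 :: complex and S S' f \<phi>
  assumes p_neq: "cls p1 \<noteq> cls p2" and q_neq: "cls q1 \<noteq> cls q2"
    and S_eq: "S = {cls p1, cls p2}" and S'_eq: "S' = {cls q1, cls q2}"
    and iso: "ringed_iso (node_curve \<tau> S) (node_curve \<tau> S') f \<phi>"
begin

definition fpre :: "complex set option set \<Rightarrow> complex set option set" where
  "fpre V = {x \<in> range (node_class S). f x \<in> V}"

lemma node_class_in_fpre [simp]: "node_class S z \<in> fpre V \<longleftrightarrow> f (node_class S z) \<in> V"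
  by (simp add: fpre_def)

lemma finite_S: "finite S" "finite S'"
  by (simp_all add: S_eq S'_eq)

lemma homeo: "homeomorphic_map (node_top \<tau> S) (node_top \<tau> S') f"
  using iso by (simp add: ringed_iso_def node_curve_def)

lemma f_inj: "f (node_class S z) = f (node_class S w) \<longleftrightarrow> node_class S z = node_class S w"
  using homeomorphic_imp_injective_map[OF homeo] by (auto simp: topspace_node inj_on_def)

lemma f_range: "f ` range (node_class S) = range (node_class S')"
  using homeomorphic_imp_surjective_map[OF homeo] by (simp add: topspace_node)

lemma openin_f_image: "openin (node_top \<tau> S) U \<Longrightarrow> openin (node_top \<tau> S') (f ` U)"
  using homeomorphic_imp_open_map[OF homeo] by (simp add: open_map_def)

lemma openin_fpre: "openin (node_top \<tau> S') V \<Longrightarrow> openin (node_top \<tau> S) (fpre V)"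
  using homeomorphic_imp_continuous_map[OF homeo]
  by (simp add: continuous_map_def topspace_node fpre_def)

lemma open_f_preimage: "openin (node_top \<tau> S') V \<Longrightarrow> open {z. f (node_class S z) \<in> V}"
  using openin_fpre[of V] by (simp add: openin_node)

lemma pre_eq: "pre (node_curve \<tau> S) f V = fpre V"
  by (simp add: pre_def fpre_def node_curve_def topspace_node)

lemma phi_iso:
  "openin (node_top \<tau> S') V \<Longrightarrow>
    \<phi> V \<in> ring_iso (function_ring (node_preimage \<tau> S' V) (node_sections \<tau> S' V))
      (function_ring (node_preimage \<tau> S (fpre V)) (node_sections \<tau> S (fpre V)))"
  using iso by (simp add: ringed_iso_def pre_eq) (simp add: node_curve_def)

lemma phi_scalar:
  "openin (node_top \<tau> S') V \<Longrightarrow>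
    \<phi> V (\<lambda>P\<in>node_preimage \<tau> S' V. c) = (\<lambda>P\<in>node_preimage \<tau> S (fpre V). c)"
  using iso by (simp add: ringed_iso_def pre_eq) (simp add: node_curve_def)

lemma phi_restr:
  "\<lbrakk>openin (node_top \<tau> S') V; openin (node_top \<tau> S') W; W \<subseteq> V; h \<in> node_sections \<tau> S' V\<rbrakk> \<Longrightarrow>
    \<phi> W (restrict h (node_preimage \<tau> S' W)) = restrict (\<phi> V h) (node_preimage \<tau> S (fpre W))"
  using iso by (simp add: ringed_iso_def pre_eq) (simp add: node_curve_def function_ring_def)

text \<open>Removing the node disconnects its small neighbourhoods, which no other point does.\<close>

lemma f_node: "f None = None"
proof (rule ccontr)
  assume ne: "f None \<noteq> None"
  have p: "node_class S p1 = None" "node_class S p2 = None" by (simp_all add: S_eq)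
  then have "f None \<in> range (node_class S')" using f_range by (metis imageI rangeI)
  then obtain b where b: "f None = node_class S' b" by blast
  then have bS: "cls b \<notin> S'" using ne by auto
  obtain r where r: "r > 0" "inj_on cls (ball p1 r \<union> ball p2 r)"
      "\<And>x y. x \<in> ball p1 r \<Longrightarrow> y \<in> ball p2 r \<Longrightarrow> cls x \<noteq> cls y"
    using inj_on_cls_two_balls[OF p_neq] by blast
  define B1 where "B1 = ball p1 r - {p1}"
  define B2 where "B2 = ball p2 r - {p2}"
  have p_in: "p1 \<in> ball p1 r" "p2 \<in> ball p2 r" using r(1) by auto
  have away1: "cls z \<notin> S" if "z \<in> B1" for z
    using that r(3)[OF _ p_in(2), of z] inj_onD[OF r(2), of z p1] p_in by (auto simp: S_eq B1_def)
  have away2: "cls z \<notin> S" if "z \<in> B2" for z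
    using that r(3)[OF p_in(1), of z] inj_onD[OF r(2), of z p2] p_in by (auto simp: S_eq B2_def)
  define V where "V = f ` node_class S ` (ball p1 r \<union> ball p2 r)"
  have "openin (node_top \<tau> S) (node_class S ` (ball p1 r \<union> ball p2 r))"
    using p_in by (intro openin_node_class_image_node) (auto simp: S_eq)
  then have "openin (node_top \<tau> S') V" unfolding V_def by (rule openin_f_image)
  then have "open ({w. node_class S' w \<in> V} \<inter> - {w. cls w \<in> S'})"
    using closed_class_preimage[OF finite_S(2)] by (simp add: openin_node open_Int open_Compl)
  moreover have "f (node_class S p1) \<in> V" unfolding V_def using p_in by blast
  then have "b \<in> {w. node_class S' w \<in> V} \<inter> - {w. cls w \<in> S'}" using bS b p by simp
  ultimately obtain s0 where s0: "s0 > 0" "ball b s0 \<subseteq> {w. node_class S' w \<in> V} \<inter> - {w. cls w \<in> S'}"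
    using open_contains_ball by blast
  define s where "s = min s0 (gap / 2)"
  have s: "s > 0" "ball b s \<subseteq> {w. node_class S' w \<in> V} \<inter> - {w. cls w \<in> S'}" "ball b s \<subseteq> ball b (gap / 2)"
    using s0 gap_pos by (auto simp: s_def)
  note s = s(1,2) inj_on_subset[OF inj_on_cls_ball s(3)]
  \<comment> \<open>If the node went to the ordinary point \<open>b\<close>, this connected
    punctured disc would be split into two nonempty open parts, coming from the punctured branches
    \<open>B1\<close> and \<open>B2\<close>.\<close>
  define C where "C = ball b s - {b}"
  have "connected C" unfolding C_def by (rule connected_punctured_ball) simp
  define M where "M B = {w. node_class S' w \<in> f ` node_class S ` B}" for B
  have open_M: "open (M B)" if "open B" "\<And>z. z \<in> B \<Longrightarrow> cls z \<notin> S" for B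
    using openin_f_image[OF openin_node_class_image[OF that]] by (simp add: M_def openin_node)
  have M12: "open (M B1)" "open (M B2)"
    using away1 away2 by (auto intro!: open_M simp: B1_def B2_def)
  have disj: "M B1 \<inter> M B2 \<inter> C = {}"
  proof -
    have False if w: "w \<in> M B1" "w \<in> M B2" for w
    proof -
      obtain x y where xy: "x \<in> B1" "y \<in> B2" "node_class S' w = f (node_class S x)"
          "node_class S' w = f (node_class S y)"
        using w by (auto simp: M_def)
      then have "node_class S x = node_class S y" using f_inj by metis
      then have "cls x = cls y" using away1[OF xy(1)] away2[OF xy(2)] by (simp add: node_class_outside)
      then show False using r(3)[of x y] xy by (auto simp: B1_def B2_def)
    qed
    then show ?thesis by blast
  qed
  have cover: "C \<subseteq> M B1 \<union> M B2"
  proof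
    fix w assume w: "w \<in> C"
    then have "w \<in> ball b s" "w \<noteq> b" by (auto simp: C_def)
    then have "node_class S' w \<in> V" "cls w \<notin> S'" "cls w \<noteq> cls b"
      using s(2) inj_onD[OF s(3), of w b] s(1) by auto
    then obtain x where x: "x \<in> ball p1 r \<union> ball p2 r" "node_class S' w = f (node_class S x)"
      unfolding V_def by blast
    have "node_class S' w \<noteq> f None"
      using b bS \<open>cls w \<notin> S'\<close> \<open>cls w \<noteq> cls b\<close> by (simp add: node_class_outside)
    then have "x \<noteq> p1" "x \<noteq> p2" using x(2) p by metis+
    then have "x \<in> B1 \<union> B2" using x(1) by (auto simp: B1_def B2_def)
    then show "w \<in> M B1 \<union> M B2" using x(2) by (auto simp: M_def)
  qed
  \<comment> \<open>By continuity at \<open>p\<close>, points of the branch close to the node land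
    in the disc around \<open>b\<close>; injectivity of \<open>f\<close> keeps them off
    \<open>b\<close> itself.\<close>
  have meets: "M (ball p r - {p}) \<inter> C \<noteq> {}" if pS: "node_class S p = None"
    and away: "\<And>z. z \<in> ball p r - {p} \<Longrightarrow> cls z \<notin> S" for p
  proof -
    have "openin (node_top \<tau> S') (node_class S' ` ball b s)"
      using s(2) by (intro openin_node_class_image) auto
    then have "open {z. f (node_class S z) \<in> node_class S' ` ball b s}" by (rule open_f_preimage)
    moreover have "p \<in> {z. f (node_class S z) \<in> node_class S' ` ball b s}"
      unfolding mem_Collect_eq pS b using s(1) by simp
    ultimately have "eventually (\<lambda>z. f (node_class S z) \<in> node_class S' ` ball b s) (at p)"
      using eventually_at_topological by blast
    moreover have "eventually (\<lambda>z. z \<in> ball p r - {p}) (at p)"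
      using r(1) eventually_at_ball'[of r p UNIV] by simp
    ultimately have "eventually (\<lambda>z. f (node_class S z) \<in> node_class S' ` ball b s \<and> z \<in> ball p r - {p}) (at p)"
      by (rule eventually_conj)
    then obtain z where z: "f (node_class S z) \<in> node_class S' ` ball b s" "z \<in> ball p r - {p}"
      using eventually_happens'[OF at_neq_bot] by blast
    then obtain w where w: "w \<in> ball b s" "f (node_class S z) = node_class S' w" by blast
    have "node_class S z \<noteq> node_class S p" using away[OF z(2)] pS by (metis node_class_eq_None)
    then have "f (node_class S z) \<noteq> f None" using f_inj pS by metis
    then have "w \<noteq> b" using w b by auto
    then have "w \<in> C" using w by (simp add: C_def)
    moreover have "w \<in> M (ball p r - {p})" unfolding M_def using w z(2) by (metis (mono_tags) imageI mem_Collect_eq)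
    ultimately show ?thesis by blast
  qed
  have "M B1 \<inter> C \<noteq> {}" "M B2 \<inter> C \<noteq> {}"
    using meets[OF p(1)] meets[OF p(2)] away1 away2 unfolding B1_def B2_def by blast+
  then show False
    using connectedD[OF \<open>connected C\<close> M12 disj cover] by blast
qed

lemma f_eq_None_iff: "f (node_class S z) = None \<longleftrightarrow> cls z \<in> S"
proof -
  have p: "node_class S p1 = None" by (simp add: S_eq)
  show ?thesis using f_inj[of z p1] unfolding p f_node by simp
qed

text \<open>The point map read off in the plane. At points over \<open>S\<close>, where
  \<open>f\<close> gives the node, the value is \<open>the None\<close>, so it carries meaning only
  outside them.\<close>

definition u :: "complex \<Rightarrow> complex set" where "u z = the (f (node_class S z))"

lemma f_node_class: "cls z \<notin> S \<Longrightarrow> f (node_class S z) = Some (u z)"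
  unfolding u_def using f_eq_None_iff[of z] by auto

lemma u_range:
  assumes "cls z \<notin> S"
  obtains w where "u z = cls w" "cls w \<notin> S'" "f (node_class S z) = node_class S' w"
proof -
  have "f (node_class S z) \<in> range (node_class S')" using f_range by blast
  then obtain w where "f (node_class S z) = node_class S' w" by blast
  then show ?thesis using that[of w] f_node_class[OF assms] by (metis node_class_eq_Some)
qed

lemma u_inj: "\<lbrakk>cls z \<notin> S; cls w \<notin> S; u z = u w\<rbrakk> \<Longrightarrow> cls z = cls w"
  using f_inj[of z w] f_node_class[of z] f_node_class[of w] node_class_outside[of z S] node_class_outside[of w S]
  by simp

lemma u_cong: "cls z = cls w \<Longrightarrow> u z = u w"
  by (simp add: u_def node_class_def)

lemma u_surj:
  assumes "cls w \<notin> S'"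
  obtains z where "cls z \<notin> S" "u z = cls w"
proof -
  have "node_class S' w \<in> f ` range (node_class S)" using f_range by blast
  then obtain z where z: "f (node_class S z) = node_class S' w" by auto
  then have "cls z \<notin> S" using f_eq_None_iff[of z] assms by auto
  then show ?thesis using that[of z] z assms by (simp add: f_node_class)
qed

text \<open>Recovers composition with the point map from the ring structure: \<open>\<phi>\<close>
  preserves scalars and units, and a section with a zero is not a unit.\<close>

lemma phi_value:
  assumes V: "openin (node_top \<tau> S') V" "None \<notin> V" and h: "h \<in> torus_holo \<tau> (node_preimage \<tau> S' V)"
    and z: "f (node_class S z) \<in> V"
  shows "\<phi> V h \<in> torus_holo \<tau> (node_preimage \<tau> S (fpre V))" "\<phi> V h (cls z) = h (u z)"
proof -
  let ?k = "\<phi> V h" and ?c = "h (u z)"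
  have None: "None \<notin> fpre V" using V(2) f_node by (auto simp: fpre_def)
  have hs: "h \<in> node_sections \<tau> S' V" using h V(2) by (simp add: node_sections_away)
  then have "?k \<in> node_sections \<tau> S (fpre V)"
    using ring_iso_memE(1)[OF phi_iso[OF V(1)], of h] by (simp add: function_ring_def)
  then show k: "?k \<in> torus_holo \<tau> (node_preimage \<tau> S (fpre V))"
    using None by (simp add: node_sections_away)
  show "?k (cls z) = ?c"
  proof (rule ccontr)
    assume neq: "?k (cls z) \<noteq> ?c"
    have away: "cls y \<notin> S" if "f (node_class S y) \<in> V" for y
      using that V(2) f_eq_None_iff by metis
    \<comment> \<open>The open set where \<open>?k - ?c\<close> has no zero. Over the corresponding
      open set \<open>W\<close> of the target, a unit would have to match \<open>h - ?c\<close>,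
      which vanishes at \<open>u z\<close>.\<close>
    define N where "N = {y. f (node_class S y) \<in> V} \<inter> (\<lambda>y. ?k (cls y)) -` (- {?c})"
    have k_holo: "(\<lambda>y. ?k (cls y)) holomorphic_on {y. f (node_class S y) \<in> V}"
      using k by (simp add: mem_torus_holo)
    have "open N" unfolding N_def
      using holomorphic_on_imp_continuous_on[OF k_holo] open_f_preimage[OF V(1)]
      by (rule continuous_open_preimage) auto
    have zN: "z \<in> N" using z neq by (simp add: N_def)
    define U where "U = node_class S ` N"
    define W where "W = f ` U"
    have "openin (node_top \<tau> S) U" unfolding U_def
      using \<open>open N\<close> by (rule openin_node_class_image) (auto simp: N_def away)
    then have W: "openin (node_top \<tau> S') W" unfolding W_def by (rule openin_f_image)
    have WV: "W \<subseteq> V" by (auto simp: W_def U_def N_def)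
    have fpreW: "fpre W = U"
      by (auto simp: fpre_def W_def U_def f_inj)
    have NoneU: "None \<notin> U" "None \<notin> W"
      using away V(2) WV by (auto simp: U_def N_def simp del: not_None_eq)
    define D where "D = node_preimage \<tau> S U"
    define E where "E = node_preimage \<tau> S' W"
    let ?A = "function_ring E (node_sections \<tau> S' W)" and ?B = "function_ring D (node_sections \<tau> S U)"
    have iso_W: "\<phi> W \<in> ring_iso ?A ?B"
      using phi_iso[OF W] by (simp add: fpreW D_def E_def)
    have carA: "carrier ?A = torus_holo \<tau> E" and carB: "carrier ?B = torus_holo \<tau> D"
      using NoneU by (simp_all add: function_ring_def node_sections_away D_def E_def)
    have UD: "{y. cls y \<in> D} \<subseteq> N"
    proof
      fix y assume "y \<in> {y. cls y \<in> D}"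
      then obtain x where x: "x \<in> N" "node_class S y = node_class S x"
        by (auto simp: D_def U_def)
      have "cls x \<notin> S" using x(1) away by (simp add: N_def)
      then have "cls y = cls x" using x(2) by (simp add: node_class_outside)
      then show "y \<in> N" using x by (simp add: N_def)
    qed
    have kD: "?k P \<noteq> ?c" if "P \<in> D" for P
    proof -
      obtain y where y: "P = cls y" using \<open>P \<in> D\<close> by (auto simp: D_def mem_node_preimage)
      then have "y \<in> N" using \<open>P \<in> D\<close> UD by blast
      then show ?thesis by (simp add: N_def y)
    qed
    have kD_holo: "(\<lambda>y. ?k (cls y)) holomorphic_on {y. cls y \<in> D}"
      by (rule holomorphic_on_subset[OF k_holo]) (use UD in \<open>auto simp: N_def\<close>)
    have "(\<lambda>y. h (cls y)) holomorphic_on {y. cls y \<in> E}"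
      using h by (auto simp: mem_torus_holo E_def intro: holomorphic_on_subset subsetD[OF WV])
    then have hE: "restrict h E \<in> torus_holo \<tau> E" by (rule torus_holo_restrictI)
    have cE: "(\<lambda>P\<in>E. - ?c) \<in> torus_holo \<tau> E" by (intro torus_holo_restrictI holomorphic_intros)
    define e where "e = (\<lambda>P\<in>E. h P - ?c)"
    \<comment> \<open>Splitting off the constant allows \<open>\<phi> W e\<close> to be computed
      from compatibility with restriction and with scalars.\<close>
    have e_add: "e = add ?A (restrict h E) (\<lambda>P\<in>E. - ?c)"
      by (auto simp: e_def function_ring_def intro!: restrict_ext)
    have eA: "e \<in> torus_holo \<tau> E"
      unfolding e_def using \<open>(\<lambda>y. h (cls y)) holomorphic_on {y. cls y \<in> E}\<close>
      by (intro torus_holo_restrictI holomorphic_intros)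
    have "\<phi> W e = add ?B (\<phi> W (restrict h E)) (\<phi> W (\<lambda>P\<in>E. - ?c))"
      unfolding e_add using hE cE by (intro ring_iso_memE(3)[OF iso_W]) (simp_all only: carA)
    also have "\<phi> W (restrict h E) = restrict ?k D"
      using phi_restr[OF V(1) W WV hs] by (simp add: fpreW D_def E_def)
    also have "\<phi> W (\<lambda>P\<in>E. - ?c) = (\<lambda>P\<in>D. - ?c)"
      using phi_scalar[OF W] by (simp add: fpreW D_def E_def)
    finally have phi_e: "\<phi> W e = (\<lambda>P\<in>D. ?k P - ?c)"
      by (auto simp: function_ring_def intro!: restrict_ext)
    define m where "m = (\<lambda>P\<in>D. inverse (?k P - ?c))"
    have "m \<in> carrier ?B" unfolding carB m_def
      using kD by (intro torus_holo_restrictI holomorphic_intros kD_holo) auto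
    \<comment> \<open>Surjectivity supplies a preimage \<open>e'\<close> of the inverse; injectivity
      then forces the product of \<open>e\<close> and \<open>e'\<close> to be 1, although
      \<open>e\<close> vanishes at \<open>u z\<close>.\<close>
    then have "m \<in> \<phi> W ` carrier ?A"
      by (simp only: bij_betw_imp_surj_on[OF ring_iso_memE(5)[OF iso_W]])
    then obtain e' where e': "e' \<in> carrier ?A" "\<phi> W e' = m" by (elim imageE) simp
    have "(\<lambda>y. e (cls y)) holomorphic_on {y. cls y \<in> E}" "(\<lambda>y. e' (cls y)) holomorphic_on {y. cls y \<in> E}"
      using eA e'(1) unfolding carA by (simp_all add: mem_torus_holo)
    then have "(\<lambda>P\<in>E. e P * e' P) \<in> torus_holo \<tau> E"
      by (intro torus_holo_restrictI holomorphic_intros)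
    then have prod_car: "mult ?A e e' \<in> carrier ?A" unfolding carA by (simp add: function_ring_def)
    have one_car: "one ?A \<in> carrier ?A"
      unfolding carA by (simp add: function_ring_def torus_holo_restrictI)
    have "\<phi> W (mult ?A e e') = mult ?B (\<phi> W e) (\<phi> W e')"
      using eA e'(1) by (intro ring_iso_memE(2)[OF iso_W]) (simp_all only: carA)
    also have "\<dots> = one ?B"
      using kD by (auto simp: phi_e e'(2) m_def function_ring_def intro!: restrict_ext)
    also have "\<dots> = \<phi> W (one ?A)" using ring_iso_memE(4)[OF iso_W] by simp
    finally have "mult ?A e e' = one ?A"
      by (rule inj_onD[OF bij_betw_imp_inj_on[OF ring_iso_memE(5)[OF iso_W]] _ prod_car one_car])
    then have *: "mult ?A e e' (u z) = one ?A (u z)" by simp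
    obtain w where w: "u z = cls w" "f (node_class S z) = node_class S' w"
      using u_range[OF away[OF z]] by metis
    have "f (node_class S z) \<in> W" unfolding W_def U_def using zN by blast
    then have "u z \<in> E" using w by (simp add: E_def)
    then show False using * by (simp add: function_ring_def e_def)
  qed
qed

end

section \<open>Isomorphisms lift to affine maps\<close>

context torus
begin

text \<open>The difference of two lifts takes values in \<open>L\<close>, at points over
  \<open>S\<close> by a limit in this closed set. Being continuous with values in a discrete set, it
  is locally constant, so the derivative does not depend on the lift.\<close>

lemma lift_deriv_unique:
  assumes "finite S" "open U" "a \<in> U" and holo: "g holomorphic_on U" "h holomorphic_on U"
    and eq: "\<And>z. \<lbrakk>z \<in> U; cls z \<notin> S\<rbrakk> \<Longrightarrow> cls (g z) = cls (h z)"
  shows "deriv g a = deriv h a"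
proof -
  define d where "d z = g z - h z" for z
  have d: "d holomorphic_on U" unfolding d_def by (intro holomorphic_intros holo)
  have cont: "isCont d z" if "z \<in> U" for z
    using holomorphic_on_imp_continuous_on[OF d] that assms(2) by (simp add: continuous_on_eq_continuous_at)
  have dL: "d z \<in> L" if "z \<in> U" for z
  proof (rule Lim_in_closed_set[OF closed_lattice])
    show "(d \<longlongrightarrow> d z) (at z)" using cont[OF that] by (simp add: isCont_def)
    have "eventually (\<lambda>y. y \<in> U) (at z)" using assms(2) that by (simp add: eventually_at_in_open')
    with eventually_cls_notin[OF assms(1), of z] show "eventually (\<lambda>y. d y \<in> L) (at z)"
      by eventually_elim (use eq in \<open>simp add: d_def torus_class_eq_iff\<close>)
  qed simp
  have "eventually (\<lambda>z. dist (d z) (d a) < gap) (nhds a)"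
    using cont[OF assms(3)] gap_pos by (intro tendstoD) (simp_all add: isCont_def tendsto_nhds_iff)
  moreover have "eventually (\<lambda>z. z \<in> U) (nhds a)" using assms(2,3) by (rule eventually_nhds_in_open)
  ultimately have "eventually (\<lambda>z. d z = d a) (nhds a)"
    by eventually_elim (use dL assms(3) lattice_separated in blast)
  then have "deriv d a = deriv (\<lambda>_. d a) a" by (rule deriv_cong_ev) simp
  moreover have "deriv d a = deriv g a - deriv h a"
    unfolding d_def using holo assms(2,3) by (intro deriv_diff) (auto simp: holomorphic_on_imp_differentiable_at)
  ultimately show ?thesis by simp
qed

text \<open>All values are already taken on the compact fundamental parallelogram \<open>K\<close>,
  which gives the bound for Liouville's theorem.\<close>

lemma periodic_entire_constant:
  assumes D: "D holomorphic_on UNIV" and per: "\<And>z l. l \<in> L \<Longrightarrow> D (z + l) = D z"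
  obtains \<gamma> where "\<And>z. D z = \<gamma>"
proof -
  define K where "K = (\<lambda>(x, y). complex_of_real x + complex_of_real y * \<tau>) ` ({0..1} \<times> {0..1})"
  have "compact K" unfolding K_def
    by (intro compact_continuous_image compact_Times compact_Icc) (auto simp: case_prod_unfold intro!: continuous_intros)
  moreover have "continuous_on K D"
    using holomorphic_on_imp_continuous_on[OF D] continuous_on_subset by blast
  ultimately have "bounded (D ` K)" using compact_continuous_image compact_imp_bounded by blast
  moreover have "range D \<subseteq> D ` K"
  proof
    fix v assume "v \<in> range D"
    then obtain z where z: "v = D z" by blast
    define y where "y = Im z / Im \<tau>"
    define x where "x = Re z - y * Re \<tau>"
    have "z = of_real x + of_real y * \<tau>" using Im_pos by (simp add: complex_eq_iff x_def y_def)
    then have "z = (of_real (frac x) + of_real (frac y) * \<tau>) + (of_int \<lfloor>x\<rfloor> + of_int \<lfloor>y\<rfloor> * \<tau>)"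
      by (simp add: frac_def algebra_simps)
    then have "D z = D (of_real (frac x) + of_real (frac y) * \<tau>)"
      using per[OF period_latticeI] by metis
    moreover have "of_real (frac x) + of_real (frac y) * \<tau> \<in> K"
      unfolding K_def using frac_lt_1[of x] frac_lt_1[of y] by (intro image_eqI[of _ _ "(frac x, frac y)"]) auto
    ultimately show "v \<in> D ` K" using z by blast
  qed
  ultimately have "bounded (range D)" by (rule bounded_subset)
  then show ?thesis using Liouville_theorem[OF D] that by (auto simp: constant_on_def)
qed

end

section \<open>Local lifts and the affine form of the point map\<close>

context node_iso
begin

text \<open>\<open>G\<close> is the pullback to the plane of the image under \<open>\<phi>\<close>
  of the inverse of the projection on \<open>B\<close>; by \<open>phi_value\<close> it represents
  \<open>u\<close>. The set \<open>B\<close> may be disconnected, as it is near the glued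
  points.\<close>

lemma lift_into:
  assumes B: "open B" "inj_on cls B" "\<And>w. w \<in> B \<Longrightarrow> cls w \<notin> S'"
  obtains G where "open {z. cls z \<notin> S \<and> u z \<in> cls ` B}" "G holomorphic_on {z. cls z \<notin> S \<and> u z \<in> cls ` B}"
    "\<And>z. \<lbrakk>cls z \<notin> S; u z \<in> cls ` B\<rbrakk> \<Longrightarrow> G z \<in> B \<and> cls (G z) = u z"
proof -
  define V where "V = node_class S' ` B"
  have V: "openin (node_top \<tau> S') V"
    unfolding V_def using B by (intro openin_node_class_image) auto
  have NV: "None \<notin> V" using B(3) by (auto simp: V_def)
  have V_Some: "Some P \<in> V \<longleftrightarrow> P \<in> cls ` B" for P using B(3) by (auto simp: V_def image_iff)
  have preV: "node_preimage \<tau> S' V = cls ` B"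
  proof -
    have "node_class S' w \<in> V \<longleftrightarrow> cls w \<in> cls ` B" for w
    proof (cases "cls w \<in> S'")
      case True
      then show ?thesis using NV B(3) by (metis image_iff node_class_eq_None)
    next
      case False
      then show ?thesis using V_Some by (simp add: node_class_outside)
    qed
    then show ?thesis unfolding set_eq_iff mem_node_preimage by blast
  qed
  have fV: "f (node_class S z) \<in> V \<longleftrightarrow> cls z \<notin> S \<and> u z \<in> cls ` B" for z
    using NV V_Some f_eq_None_iff[of z] f_node_class[of z] by (cases "cls z \<in> S") auto
  let ?h = "restrict (inv_into B cls) (cls ` B)"
  have h: "?h \<in> torus_holo \<tau> (node_preimage \<tau> S' V)"
    using local_inverse_holo[OF B(1,2)] by (simp add: preV)
  have op: "open {z. cls z \<notin> S \<and> u z \<in> cls ` B}"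
    using open_f_preimage[OF V] by (simp add: fV)
  \<comment> \<open>\<open>phi_value\<close> is stated at a point over \<open>V\<close>; if there is
    none, any function serves as \<open>G\<close>.\<close>
  show ?thesis
  proof (cases "{z. cls z \<notin> S \<and> u z \<in> cls ` B} = {}")
    case True
    show ?thesis by (rule that[OF op, of "\<lambda>z. z"]) (use True in \<open>auto intro: holomorphic_intros\<close>)
  next
    case False
    then obtain a where "f (node_class S a) \<in> V" using fV by blast
    then have "\<phi> V ?h \<in> torus_holo \<tau> (node_preimage \<tau> S (fpre V))"
      by (rule phi_value(1)[OF V NV h])
    then have "(\<lambda>z. \<phi> V ?h (cls z)) holomorphic_on {z. cls z \<notin> S \<and> u z \<in> cls ` B}"
      by (simp add: mem_torus_holo fV)
    moreover have "\<phi> V ?h (cls z) \<in> B \<and> cls (\<phi> V ?h (cls z)) = u z" if "cls z \<notin> S" "u z \<in> cls ` B" for z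
    proof -
      have "\<phi> V ?h (cls z) = ?h (u z)" using that fV by (intro phi_value(2)[OF V NV h]) blast
      then show ?thesis using that(2) inv_into_into[OF that(2)] f_inv_into_f[OF that(2)] by simp
    qed
    ultimately show ?thesis using that op by blast
  qed
qed

lemma local_lift:
  "\<exists>s>0. \<exists>g. g holomorphic_on ball a s \<and> (\<forall>z\<in>ball a s. cls z \<notin> S \<longrightarrow> u z = cls (g z))"
proof (cases "cls a \<in> S")
  case False
  then obtain b where b: "u a = cls b" "cls b \<notin> S'" using u_range by metis
  define B where "B = ball b (gap / 2) \<inter> - {w. cls w \<in> S'}"
  have B: "open B" "inj_on cls B" "\<And>w. w \<in> B \<Longrightarrow> cls w \<notin> S'"
    using closed_class_preimage[OF finite_S(2)] inj_on_subset[OF inj_on_cls_ball[of b], of B]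
    by (auto simp: B_def)
  obtain G where G: "open {z. cls z \<notin> S \<and> u z \<in> cls ` B}" "G holomorphic_on {z. cls z \<notin> S \<and> u z \<in> cls ` B}"
    "\<And>z. \<lbrakk>cls z \<notin> S; u z \<in> cls ` B\<rbrakk> \<Longrightarrow> G z \<in> B \<and> cls (G z) = u z"
    using lift_into[OF B] by blast
  have "b \<in> B" using b gap_pos by (simp add: B_def)
  then have "a \<in> {z. cls z \<notin> S \<and> u z \<in> cls ` B}" using False b by simp
  then obtain s where s: "s > 0" "ball a s \<subseteq> {z. cls z \<notin> S \<and> u z \<in> cls ` B}"
    using G(1) open_contains_ball by blast
  then have "G holomorphic_on ball a s" "\<forall>z\<in>ball a s. u z = cls (G z)"
    using holomorphic_on_subset[OF G(2)] G(3) by auto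
  then show ?thesis using s(1) by blast
next
  case True
  \<comment> \<open>Near a glued point the image is only known to be near the node, hence near the
    class of \<open>q1\<close> or of \<open>q2\<close>. One chart made of both discs covers the two
    possibilities at once.\<close>
  obtain r where r: "r > 0" "inj_on cls (ball q1 r \<union> ball q2 r)"
    using inj_on_cls_two_balls[OF q_neq] by metis
  define B0 where "B0 = ball q1 r \<union> ball q2 r"
  define B where "B = B0 \<inter> - {w. cls w \<in> S'}"
  have "open B0" by (simp add: B0_def open_Un)
  have B: "open B" "inj_on cls B" "\<And>w. w \<in> B \<Longrightarrow> cls w \<notin> S'"
    using closed_class_preimage[OF finite_S(2)] inj_on_subset[OF r(2), of B] \<open>open B0\<close>
    by (auto simp: B_def B0_def)
  obtain G where G: "open {z. cls z \<notin> S \<and> u z \<in> cls ` B}" "G holomorphic_on {z. cls z \<notin> S \<and> u z \<in> cls ` B}"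
    "\<And>z. \<lbrakk>cls z \<notin> S; u z \<in> cls ` B\<rbrakk> \<Longrightarrow> G z \<in> B \<and> cls (G z) = u z"
    using lift_into[OF B] by blast
  have q_in: "q1 \<in> B0" "q2 \<in> B0" using r(1) by (auto simp: B0_def)
  then have "openin (node_top \<tau> S') (node_class S' ` B0)"
    using \<open>open B0\<close> by (intro openin_node_class_image_node) (auto simp: S'_eq)
  then have "open {z. f (node_class S z) \<in> node_class S' ` B0}" by (rule open_f_preimage)
  moreover have "node_class S' q1 = None" by (simp add: S'_eq)
  then have "f (node_class S a) \<in> node_class S' ` B0"
    using True f_eq_None_iff[of a] q_in(1) by (metis imageI)
  ultimately have "eventually (\<lambda>z. f (node_class S z) \<in> node_class S' ` B0) (at a)"
    by (metis (mono_tags, lifting) eventually_at_topological mem_Collect_eq)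
  with eventually_cls_notin[OF finite_S(1), of a]
  have "eventually (\<lambda>z. cls z \<notin> S \<and> u z \<in> cls ` B) (at a)"
  proof eventually_elim
    case (elim z)
    then obtain w where w: "w \<in> B0" "Some (u z) = node_class S' w" using f_node_class[of z] by auto
    then have "u z = cls w" "w \<in> B" by (auto simp: B_def)
    then show ?case using elim by blast
  qed
  then obtain s where s: "s > 0" "\<And>z. \<lbrakk>z \<noteq> a; dist z a < s\<rbrakk> \<Longrightarrow> cls z \<notin> S \<and> u z \<in> cls ` B"
    unfolding eventually_at by auto
  have sub: "ball a s - {a} \<subseteq> {z. cls z \<notin> S \<and> u z \<in> cls ` B}"
    using s(2) by (auto simp: dist_commute)
  \<comment> \<open>The lift on the punctured disc takes its values in \<open>B\<close>; this is the
    bound that lets it extend across \<open>a\<close>.\<close>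
  have "bounded B" unfolding B_def B0_def by (rule bounded_subset[of "ball q1 r \<union> ball q2 r"]) auto
  then obtain M where M: "\<And>w. w \<in> B \<Longrightarrow> norm w \<le> M" by (auto simp: bounded_iff)
  have "eventually (\<lambda>z. z \<in> ball a s - {a}) (at a)"
    using s(1) eventually_at_ball'[of s a UNIV] by simp
  then have "eventually (\<lambda>z. norm (G z) \<le> M) (at a)"
    by eventually_elim (use M G(3) sub in blast)
  then have "\<exists>g. g holomorphic_on ball a s \<and> (\<forall>z\<in>ball a s - {a}. g z = G z)"
    using s(1) holomorphic_on_subset[OF G(2) sub]
    by (subst holomorphic_on_extend_bounded) auto
  then obtain g where g: "g holomorphic_on ball a s" "\<And>z. z \<in> ball a s - {a} \<Longrightarrow> g z = G z" by blast
  have "u z = cls (g z)" if z: "z \<in> ball a s" "cls z \<notin> S" for z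
  proof -
    have "z \<in> ball a s - {a}" using z True by auto
    then show ?thesis using g(2) G(3) sub by fastforce
  qed
  then show ?thesis using s(1) g(1) by blast
qed

lemma u_affine:
  obtains \<gamma> c where "\<And>z. cls z \<notin> S \<Longrightarrow> u z = cls (\<gamma> * z + c)"
proof -
  obtain r g where r: "\<And>a. r a > 0" and g: "\<And>a. g a holomorphic_on ball a (r a)"
    and lift: "\<And>a z. \<lbrakk>z \<in> ball a (r a); cls z \<notin> S\<rbrakk> \<Longrightarrow> u z = cls (g a z)"
    using local_lift by metis
  \<comment> \<open>Only derivatives fit together: the lifts themselves may differ by lattice
    vectors on overlaps.\<close>
  define D where "D a = deriv (g a) a" for a
  have D_eq: "D z = deriv (g a) z" if z: "z \<in> ball a (r a)" for a z
    unfolding D_def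
  proof (rule lift_deriv_unique[OF finite_S(1)])
    show "open (ball a (r a) \<inter> ball z (r z))" by auto
    show "z \<in> ball a (r a) \<inter> ball z (r z)" using z r by auto
    show "cls (g z y) = cls (g a y)" if "y \<in> ball a (r a) \<inter> ball z (r z)" "cls y \<notin> S" for y
      using lift[of y a] lift[of y z] that by auto
  qed (auto intro: holomorphic_on_subset[OF g])
  have "D holomorphic_on ball a (r a)" for a
    by (rule holomorphic_transform[OF holomorphic_deriv[OF g open_ball]]) (simp add: D_eq)
  then have "D holomorphic_on (\<Union>a. ball a (r a))"
    by (intro holomorphic_on_UN_open) auto
  moreover have "(\<Union>a. ball a (r a)) = UNIV" using r by fastforce
  ultimately have "D holomorphic_on UNIV" by simp
  moreover have "D (z + l) = D z" if l: "l \<in> L" for z l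
  proof -
    \<comment> \<open>Shifting the lift at \<open>z + l\<close> back by \<open>l\<close> gives a
      second lift near \<open>z\<close>, since \<open>u\<close> depends only on the class.\<close>
    let ?g = "\<lambda>w. g (z + l) (w + l)"
    let ?U = "ball z (r z) \<inter> ball z (r (z + l))"
    have "g (z + l) \<circ> (\<lambda>w. w + l) holomorphic_on ?U"
      using g by (intro holomorphic_on_compose_gen[where t = "ball (z + l) (r (z + l))"] holomorphic_intros)
        (auto simp: dist_norm)
    then have g': "?g holomorphic_on ?U" by (simp add: o_def)
    have gz: "g z holomorphic_on ?U" by (rule holomorphic_on_subset[OF g]) auto
    have "cls (g (z + l) (y + l)) = cls (g z y)" if y: "y \<in> ?U" "cls y \<notin> S" for y
      using lift[of "y + l" "z + l"] lift[of y z] y l u_cong[of "y + l" y] by (auto simp: dist_norm)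
    from lift_deriv_unique[OF finite_S(1) _ _ g' gz this] have "deriv ?g z = deriv (g z) z"
      using r by (auto simp: open_Int)
    moreover have "(g (z + l) has_field_derivative deriv (g (z + l)) (z + l)) (at (z + l))"
      using holomorphic_derivI[OF g open_ball, of "z + l" "z + l"] r by simp
    then have "(?g has_field_derivative D (z + l)) (at z)" by (simp add: D_def DERIV_shift)
    then have "deriv ?g z = D (z + l)" by (rule DERIV_imp_deriv)
    ultimately show ?thesis by (simp add: D_def)
  qed
  ultimately obtain \<gamma> where \<gamma>: "\<And>z. D z = \<gamma>" using periodic_entire_constant by metis
  have "\<exists>c. \<forall>z\<in>ball a (r a). g a z - \<gamma> * z = c" for a
  proof (rule has_field_derivative_zero_constant[OF convex_ball])
    fix z assume z: "z \<in> ball a (r a)"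
    have "(g a has_field_derivative \<gamma>) (at z)"
      using holomorphic_derivI[OF g open_ball z] D_eq[OF z] \<gamma> by simp
    then have "((\<lambda>z. g a z - \<gamma> * z) has_field_derivative \<gamma> - \<gamma>) (at z)"
      by (intro derivative_eq_intros) auto
    then show "((\<lambda>z. g a z - \<gamma> * z) has_field_derivative 0) (at z within ball a (r a))"
      by (simp add: has_field_derivative_at_within)
  qed
  then obtain C where C: "\<And>a z. z \<in> ball a (r a) \<Longrightarrow> g a z - \<gamma> * z = C a" by metis
  have u_eq: "u z = cls (\<gamma> * z + C a)" if z: "z \<in> ball a (r a)" "cls z \<notin> S" for a z
    using lift[OF z] C[OF z(1)] by (metis add.commute diff_add_cancel)
  \<comment> \<open>The numbers \<open>C a\<close> may jump by lattice vectors from ball to ball,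
    but their classes agree, as comparison at one common point outside \<open>S\<close>
    shows.\<close>
  have "(\<lambda>a. cls (C a)) constant_on UNIV"
  proof (rule locally_constant_imp_constant[OF connected_UNIV])
    fix a :: complex
    have const: "cls (C z) = cls (C a)" if z: "z \<in> ball a (r a)" for z
    proof -
      have "eventually (\<lambda>w. w \<in> ball a (r a) \<inter> ball z (r z)) (at z)"
        using z r by (intro eventually_at_in_open') auto
      with eventually_cls_notin[OF finite_S(1), of z]
      have "eventually (\<lambda>w. cls w \<notin> S \<and> w \<in> ball a (r a) \<inter> ball z (r z)) (at z)"
        by (rule eventually_conj)
      then obtain w where "cls w \<notin> S" "w \<in> ball a (r a)" "w \<in> ball z (r z)"
        using eventually_happens'[OF at_neq_bot] by blast
      then have "cls (\<gamma> * w + C a) = cls (\<gamma> * w + C z)" using u_eq by metis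
      then show ?thesis by (simp add: torus_class_eq_iff period_lattice_diff_commute)
    qed
    show "\<exists>T. openin (top_of_set UNIV) T \<and> a \<in> T \<and> (\<forall>z\<in>T. cls (C z) = cls (C a))"
    proof (intro exI conjI ballI)
      show "openin (top_of_set UNIV) (ball a (r a))" by simp
      show "a \<in> ball a (r a)" using r by simp
    qed (rule const)
  qed
  then obtain \<kappa> where "\<And>a. cls (C a) = \<kappa>" by (auto simp: constant_on_def)
  then have const: "cls (C a) = cls (C 0)" for a by simp
  have "u z = cls (\<gamma> * z + C 0)" if "cls z \<notin> S" for z
    using u_eq[of z z] r that const[of z] by (simp add: torus_class_eq_iff)
  then show ?thesis by (rule that)
qed

text \<open>Two countable sets cannot cover the plane. The pair \<open>z\<close>,
  \<open>z + w\<close> serves to test how the point map treats translation by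
  \<open>w\<close>.\<close>

lemma exists_outside:
  obtains z where "cls z \<notin> S" "cls (z + w) \<notin> S"
proof -
  have "countable ({z. cls z \<in> S} \<union> (\<lambda>z. z - w) ` {z. cls z \<in> S})"
    using countable_class_preimage[OF finite_S(1)] by auto
  then obtain z where z: "z \<notin> {z. cls z \<in> S} \<union> (\<lambda>z. z - w) ` {z. cls z \<in> S}"
    using uncountable_UNIV_complex by (metis UNIV_eq_I)
  have "cls (z + w) \<notin> S"
  proof
    assume "cls (z + w) \<in> S"
    then have "z \<in> (\<lambda>z. z - w) ` {z. cls z \<in> S}" by (intro image_eqI[of _ _ "z + w"]) auto
    then show False using z by blast
  qed
  then show ?thesis using that z by blast
qed

lemma affine_witness:
  obtains \<gamma> c where "(\<lambda>w. \<gamma> * w) ` L = L" "S' = {cls (\<gamma> * p1 + c), cls (\<gamma> * p2 + c)}"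
proof -
  obtain \<gamma> c where uc: "\<And>z. cls z \<notin> S \<Longrightarrow> u z = cls (\<gamma> * z + c)" using u_affine by blast
  \<comment> \<open>Two points differing by \<open>w\<close> have the same class exactly when their
    images do: one direction is well-definedness of \<open>u\<close> on classes, the other its
    injectivity.\<close>
  have mult_iff: "\<gamma> * w \<in> L \<longleftrightarrow> w \<in> L" for w
  proof -
    obtain z where z: "cls z \<notin> S" "cls (z + w) \<notin> S" by (rule exists_outside)
    have "w \<in> L \<longleftrightarrow> cls (z + w) = cls z" by (simp add: torus_class_eq_iff)
    also have "\<dots> \<longleftrightarrow> u (z + w) = u z" using u_inj[OF z(2,1)] u_cong by blast
    also have "\<dots> \<longleftrightarrow> \<gamma> * w \<in> L" using z by (simp add: uc torus_class_eq_iff algebra_simps)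
    finally show ?thesis by simp
  qed
  have ne: "\<gamma> \<noteq> 0"
  proof
    assume "\<gamma> = 0"
    then have "L = UNIV" using mult_iff by auto
    then show False using countable_period_lattice[of \<tau>] uncountable_UNIV_complex by simp
  qed
  have onto: "l \<in> (\<lambda>w. \<gamma> * w) ` L" if "l \<in> L" for l
    using mult_iff[of "l / \<gamma>"] that ne by (intro image_eqI[of _ _ "l / \<gamma>"]) auto
  then have L: "(\<lambda>w. \<gamma> * w) ` L = L" using mult_iff by auto
  \<comment> \<open>If the affine map took a glued point to an ordinary one, surjectivity of
    \<open>u\<close> would give that point a preimage outside \<open>S\<close> as well, against
    injectivity of the affine map modulo \<open>L\<close>.\<close>
  have node: "cls (\<gamma> * p + c) \<in> S'" if p: "cls p \<in> S" for p
  proof (rule ccontr)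
    assume "cls (\<gamma> * p + c) \<notin> S'"
    then obtain z where z: "cls z \<notin> S" "u z = cls (\<gamma> * p + c)" by (rule u_surj)
    then have "\<gamma> * (z - p) \<in> L" by (simp add: uc torus_class_eq_iff algebra_simps)
    then have "cls z = cls p" by (simp add: mult_iff torus_class_eq_iff)
    then show False using z p by simp
  qed
  have "cls (\<gamma> * p1 + c) \<noteq> cls (\<gamma> * p2 + c)"
    using p_neq mult_iff[of "p1 - p2"] by (simp add: torus_class_eq_iff algebra_simps)
  then have "S' = {cls (\<gamma> * p1 + c), cls (\<gamma> * p2 + c)}"
    using node[of p1] node[of p2] by (auto simp: S_eq S'_eq)
  with L show ?thesis by (rule that)
qed

end

section \<open>The congruence criterion for the differences of the glued points\<close>

theorem proposition6p5:
  fixes \<tau> z1 z2 z1' z2' :: complex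
  assumes "Im \<tau> > 0"
    and "torus_class \<tau> z1 \<noteq> torus_class \<tau> z2"
    and "torus_class \<tau> z1' \<noteq> torus_class \<tau> z2'"
  shows "biholomorphic (node_curve \<tau> {torus_class \<tau> z1, torus_class \<tau> z2})
                       (node_curve \<tau> {torus_class \<tau> z1', torus_class \<tau> z2'}) \<longleftrightarrow>
         (\<exists>\<gamma>::complex.
            (if square_lattice (period_lattice \<tau>) then \<gamma> ^ 4 = 1
             else if hexagonal_lattice (period_lattice \<tau>) then \<gamma> ^ 6 = 1
             else \<gamma> = 1 \<or> \<gamma> = -1) \<and>
            (z1' - z2') - \<gamma> * (z1 - z2) \<in> period_lattice \<tau>)"
proof -
  interpret torus \<tau> using assms(1) by unfold_locales
  show ?thesis
    unfolding lattice_multiplier_iff[symmetric]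
  proof
    assume "biholomorphic (node_curve \<tau> {cls z1, cls z2}) (node_curve \<tau> {cls z1', cls z2'})"
    then obtain f \<phi> where "ringed_iso (node_curve \<tau> {cls z1, cls z2}) (node_curve \<tau> {cls z1', cls z2'}) f \<phi>"
      by (auto simp: biholomorphic_def)
    then interpret node_iso \<tau> z1 z2 z1' z2' "{cls z1, cls z2}" "{cls z1', cls z2'}" f \<phi>
      using assms by unfold_locales auto
    obtain \<gamma> c where \<gamma>: "(\<lambda>w. \<gamma> * w) ` L = L" and
      S: "{cls z1', cls z2'} = {cls (\<gamma> * z1 + c), cls (\<gamma> * z2 + c)}" by (rule affine_witness)
    \<comment> \<open>Prepares the case in which the two glued points are interchanged;
      \<open>- \<gamma>\<close> is a multiplier because \<open>L\<close> is symmetric.\<close>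
    have "(\<lambda>w. - \<gamma> * w) ` L = uminus ` (\<lambda>w. \<gamma> * w) ` L" by (simp add: image_image)
    also have "\<dots> = L" unfolding \<gamma> by (rule bij_betw_imp_surj_on[of uminus L L], rule bij_betw_byWitness[where f' = uminus]) auto
    finally have neg: "(\<lambda>w. - \<gamma> * w) ` L = L" .
    consider "z1' - (\<gamma> * z1 + c) \<in> L" "z2' - (\<gamma> * z2 + c) \<in> L"
      | "z1' - (\<gamma> * z2 + c) \<in> L" "z2' - (\<gamma> * z1 + c) \<in> L"
      using S by (auto simp: doubleton_eq_iff torus_class_eq_iff)
    then show "\<exists>\<gamma>. (\<lambda>w. \<gamma> * w) ` L = L \<and> z1' - z2' - \<gamma> * (z1 - z2) \<in> L"
    proof cases
      case 1
      from period_lattice_diff[OF this] have "z1' - z2' - \<gamma> * (z1 - z2) \<in> L"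
        by (simp add: algebra_simps)
      with \<gamma> show ?thesis by blast
    next
      case 2
      from period_lattice_diff[OF this] have "z1' - z2' - (- \<gamma>) * (z1 - z2) \<in> L"
        by (simp add: algebra_simps)
      with neg show ?thesis by blast
    qed
  next
    assume "\<exists>\<gamma>. (\<lambda>w. \<gamma> * w) ` L = L \<and> z1' - z2' - \<gamma> * (z1 - z2) \<in> L"
    then obtain \<gamma> where \<gamma>: "(\<lambda>w. \<gamma> * w) ` L = L" and diff: "z1' - z2' - \<gamma> * (z1 - z2) \<in> L" by blast
    \<comment> \<open>This translation sends \<open>z2\<close> exactly to \<open>z2'\<close>; the
      congruence then puts the image of \<open>z1\<close> into the class of
      \<open>z1'\<close>.\<close>
    let ?c = "z2' - \<gamma> * z2"
    have "\<gamma> * z1 + ?c - z1' = - (z1' - z2' - \<gamma> * (z1 - z2))" by (simp add: algebra_simps)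
    then have "cls (\<gamma> * z1 + ?c) = cls z1'" using diff by (simp only: torus_class_eq_iff period_lattice_minus_iff)
    moreover have "cls (\<gamma> * z2 + ?c) = cls z2'" by simp
    ultimately have "affine_image \<gamma> ?c ` {cls z1, cls z2} = {cls z1', cls z2'}"
      by (simp add: affine_cls[OF \<gamma>])
    moreover have "{cls z1, cls z2} \<subseteq> range cls" by auto
    ultimately show "biholomorphic (node_curve \<tau> {cls z1, cls z2}) (node_curve \<tau> {cls z1', cls z2'})"
      using biholomorphic_affine[OF \<gamma>, of "{cls z1, cls z2}" ?c] by simp
  qed
qed

end
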